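(* There is a universal constant $C_6$ such that the following holds. Let $K$ be a symmetric convex body in $\mathbb{R}^d$ and let $X^1,X^2$ be random vectors in $\mathbb{R}^d$ with densities $e^{-\varphi_i(\|x\|_K)}$, $i=1,2$, where $\varphi_i\colon[0,\infty)\to(-\infty,\infty]$ are nondecreasing convex functions. If $X^1$ satisfies $\mathrm{SMP}(\kappa)$ for some $\kappa>0$, then $X^2$ satisfies $\mathrm{SMP}(\kappa/C_6)$.
   Context: $\|x\|_K=\inf\{\lambda>0\colon x\in\lambda K\}$. $\|Y\|_p:=(\mathbb{E}|Y|^p)^{1/p}$. A random vector $X$ in $\mathbb{R}^d$ satisfies the $L_p$-Sudakov minoration principle with constant $\kappa>0$, written $\mathrm{SMP}_p(\kappa)$, if for every $A>0$ and every set $T\subset\mathbb{R}^d$ with $|T|\geq e^p$ (cardinality) such that $\|\langle t-s,X\rangle\|_p\geq A$ for all distinct $s,t\in T$, one has $\mathbb{E}\sup_{t,s\in T}\langle t-s,X\rangle\geq \kappa A$. $X$ satisfies $\mathrm{SMP}(\kappa)$ if it satisfies $\mathrm{SMP}_p(\kappa)$ for every $p\geq 1$. *)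

theory Defs
  imports "HOL-Analysis.Analysis" "HOL-Probability.Probability"
begin

text \<open>R^d is modelled as the functions nat => real that are extensional on {..<d},
  so that the dimension d can be quantified inside the statement (universal constant).\<close>

definition Rd :: "nat \<Rightarrow> (nat \<Rightarrow> real) set" where
  "Rd d = PiE {..<d} (\<lambda>_. UNIV)"

definition lebRd :: "nat \<Rightarrow> (nat \<Rightarrow> real) measure" where
  "lebRd d = PiM {..<d} (\<lambda>_. lborel)"

definition ipd :: "nat \<Rightarrow> (nat \<Rightarrow> real) \<Rightarrow> (nat \<Rightarrow> real) \<Rightarrow> real" where
  "ipd d x y = (\<Sum>i<d. x i * y i)"

definition sym_convex_body :: "nat \<Rightarrow> (nat \<Rightarrow> real) set \<Rightarrow> bool" where
  "sym_convex_body d K \<longleftrightarrow>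
     K \<subseteq> Rd d \<and> compact K \<and>
     (\<forall>x\<in>K. \<forall>y\<in>K. \<forall>u::real. 0 \<le> u \<and> u \<le> 1 \<longrightarrow>
        restrict (\<lambda>i. u * x i + (1 - u) * y i) {..<d} \<in> K) \<and>
     (\<exists>x\<in>Rd d. \<exists>r>0. {y \<in> Rd d. (\<Sum>i<d. (y i - x i)^2) < r^2} \<subseteq> K) \<and>
     (\<forall>x\<in>K. restrict (\<lambda>i. - x i) {..<d} \<in> K)"

definition mink :: "nat \<Rightarrow> (nat \<Rightarrow> real) set \<Rightarrow> (nat \<Rightarrow> real) \<Rightarrow> real" where
  "mink d K x = Inf {l::real. l > 0 \<and> (\<exists>k\<in>K. x = restrict (\<lambda>i. l * k i) {..<d})}"

definition admissible_phi :: "(real \<Rightarrow> ereal) \<Rightarrow> bool" where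
  "admissible_phi \<phi> \<longleftrightarrow>
     (\<forall>t\<ge>0. \<phi> t \<noteq> -\<infinity>) \<and>
     (\<forall>s t. 0 \<le> s \<and> s \<le> t \<longrightarrow> \<phi> s \<le> \<phi> t) \<and>
     (\<forall>x\<ge>0. \<forall>y\<ge>0. \<forall>u::real. 0 < u \<and> u < 1 \<longrightarrow>
        \<phi> (u * x + (1 - u) * y) \<le> ereal u * \<phi> x + ereal (1 - u) * \<phi> y)"

definition dens_phi :: "(real \<Rightarrow> ereal) \<Rightarrow> nat \<Rightarrow> (nat \<Rightarrow> real) set \<Rightarrow> (nat \<Rightarrow> real) \<Rightarrow> ennreal" where
  "dens_phi \<phi> d K x =
     (if \<phi> (mink d K x) = \<infinity> then 0 else ennreal (exp (- real_of_ereal (\<phi> (mink d K x)))))"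

definition lp_norm :: "'a measure \<Rightarrow> ('a \<Rightarrow> real) \<Rightarrow> real \<Rightarrow> ennreal" where
  "lp_norm \<mu> Y p =
     (let I = (\<integral>\<^sup>+ x. ennreal (\<bar>Y x\<bar> powr p) \<partial>\<mu>) in
      if I = \<infinity> then \<infinity> else ennreal (enn2real I powr (1 / p)))"

text \<open>SMP_p(kappa) for a random vector whose law on R^d is mu.  The supremum is
  nonnegative (take t = s), so its expectation is taken as a nonnegative integral.\<close>
definition SMP_p :: "nat \<Rightarrow> (nat \<Rightarrow> real) measure \<Rightarrow> real \<Rightarrow> real \<Rightarrow> bool" where
  "SMP_p d \<mu> p \<kappa> \<longleftrightarrow>
     (\<forall>A>0. \<forall>T. T \<subseteq> Rd d \<and> (infinite T \<or> exp p \<le> real (card T)) \<and>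
        (\<forall>s\<in>T. \<forall>t\<in>T. s \<noteq> t \<longrightarrow> ennreal A \<le> lp_norm \<mu> (\<lambda>x. ipd d (\<lambda>i. t i - s i) x) p)
      \<longrightarrow> ennreal (\<kappa> * A) \<le>
          (\<integral>\<^sup>+ x. (SUP ts\<in>T \<times> T. ennreal (ipd d (\<lambda>i. fst ts i - snd ts i) x)) \<partial>\<mu>))"

definition SMP :: "nat \<Rightarrow> (nat \<Rightarrow> real) measure \<Rightarrow> real \<Rightarrow> bool" where
  "SMP d \<mu> \<kappa> \<longleftrightarrow> (\<forall>p\<ge>1. SMP_p d \<mu> p \<kappa>)"

end

theory Submission
  imports Defs
begin

text \<open>A density \<open>exp (- \<phi> \<parallel>x\<parallel>)\<close> is a mixture of uniform densities on dilates of the body \<open>K\<close>, so the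
  random vector is \<open>R U\<close> with \<open>U\<close> uniform on \<open>K\<close> and \<open>R\<close> an independent radius. Since
  \<open>E R \<le> \<parallel>R\<parallel>\<^sub>p\<close>, minoration for \<open>R U\<close> implies minoration for \<open>U\<close> with the same constant. To return
  from \<open>U\<close> to the second vector one needs the reverse bound: log-concavity gives
  \<open>\<parallel>R\<parallel>\<^sub>p \<le> C (1 + p/d)\<^sup>2 E R\<close> for \<open>p \<ge> d\<close>, which suffices for \<open>p \<le> 2 d\<close>. For larger \<open>p\<close> the norms
  \<open>\<parallel>\<langle>v, U\<rangle>\<parallel>\<^sub>p\<close>, \<open>p \<ge> d\<close>, are all comparable to the support function of \<open>K\<close>, and a packing argument in
  the polar body extracts from \<open>exp p\<close> separated points \<open>exp d\<close> points with separation larger by a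
  factor of order \<open>exp (p/d)\<close>; minoration at exponent \<open>d\<close> for these beats the polynomial loss.\<close>

section \<open>Affine changes of variables\<close>

text \<open>\<open>restrict\<close> returns the result to the extensional functions that model R^d,
  whatever values \<open>t\<close> takes outside the coordinates.\<close>

definition affd :: "nat \<Rightarrow> (nat \<Rightarrow> real) \<Rightarrow> real \<Rightarrow> (nat \<Rightarrow> real) \<Rightarrow> nat \<Rightarrow> real" where
  "affd d t c x = restrict (\<lambda>i. t i + c * x i) {..<d}"

definition scld :: "nat \<Rightarrow> real \<Rightarrow> (nat \<Rightarrow> real) \<Rightarrow> nat \<Rightarrow> real" where
  "scld d c x = restrict (\<lambda>i. c * x i) {..<d}"

interpretation lborel_prod: product_sigma_finite "\<lambda>_::nat. lborel :: real measure"
  by unfold_locales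

lemma space_lebRd [simp]: "space (lebRd d) = Rd d"
  by (simp add: lebRd_def Rd_def space_PiM)

lemma sigma_finite_lebRd: "sigma_finite_measure (lebRd d)"
  unfolding lebRd_def by (rule lborel_prod.sigma_finite) simp

lemma affd_in_Rd [simp]: "affd d t c x \<in> Rd d"
  by (auto simp: affd_def Rd_def)

lemma scld_in_Rd [simp]: "scld d c x \<in> Rd d"
  by (auto simp: scld_def Rd_def)

lemma scld_eq_affd: "scld d = affd d (\<lambda>_. 0)"
  by (auto simp: scld_def affd_def fun_eq_iff)

lemma Rd_eqI: "x \<in> Rd d \<Longrightarrow> y \<in> Rd d \<Longrightarrow> (\<And>i. i < d \<Longrightarrow> x i = y i) \<Longrightarrow> x = y"
  unfolding Rd_def by (rule PiE_ext) auto

lemma measurable_component_lebRd: "i < d \<Longrightarrow> (\<lambda>x. x i) \<in> borel_measurable (lebRd d)"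
  using measurable_component_singleton[of i "{..<d}" "\<lambda>_. lborel :: real measure"]
  by (simp add: lebRd_def)

lemma measurable_affd [measurable]: "affd d t c \<in> lebRd d \<rightarrow>\<^sub>M lebRd d"
proof -
  have "(\<lambda>x. t i + c * x i) \<in> borel_measurable (lebRd d)" if "i < d" for i
    using measurable_component_lebRd[OF that] by measurable
  then show ?thesis
    unfolding lebRd_def affd_def by (intro measurable_restrict) auto
qed

lemma measurable_scld [measurable]: "scld d c \<in> lebRd d \<rightarrow>\<^sub>M lebRd d"
  unfolding scld_eq_affd by (rule measurable_affd)

lemma measurable_ipd [measurable]: "ipd d v \<in> borel_measurable (lebRd d)"
  unfolding ipd_def by (intro borel_measurable_sum borel_measurable_times borel_measurable_const
    measurable_component_lebRd) auto

text \<open>A product measure is determined by its values on boxes. The preimage of a box is again a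
  box, and each of the \<open>d\<close> coordinates contributes one factor
  \<open>\<bar>c\<bar>\<close>.\<close>

lemma distr_affd:
  assumes "c \<noteq> 0"
  shows "lebRd d = scale_measure (ennreal (\<bar>c\<bar> ^ d)) (distr (lebRd d) (lebRd d) (affd d t c))"
    (is "_ = ?P")
proof -
  have "?P = PiM {..<d} (\<lambda>_. lborel)"
  proof (rule lborel_prod.PiM_eqI)
    fix A :: "nat \<Rightarrow> real set" assume A: "\<And>i. i \<in> {..<d} \<Longrightarrow> A i \<in> sets lborel"
    let ?B = "\<lambda>i. (\<lambda>z. t i + c * z) -` A i"
    have B: "?B i \<in> sets lborel" if "i < d" for i
      using measurable_sets_borel[of "\<lambda>z. t i + c * z" borel "A i"] A[of i] that by simp
    have "affd d t c -` (PiE {..<d} A) \<inter> Rd d = PiE {..<d} ?B"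
      by (auto simp: affd_def Rd_def PiE_def Pi_def)
    moreover have "PiE {..<d} A \<in> sets (lebRd d)"
      unfolding lebRd_def using A by (intro sets_PiM_I_finite) auto
    moreover have "emeasure (lebRd d) (PiE {..<d} ?B) = (\<Prod>i<d. emeasure lborel (?B i))"
      unfolding lebRd_def using B by (subst lborel_prod.emeasure_PiM) auto
    moreover have "ennreal \<bar>c\<bar> * emeasure lborel (?B i) = emeasure lborel (A i)" if "i < d" for i
    proof -
      have "emeasure lborel (A i) = emeasure (density (distr lborel borel (\<lambda>x. t i + c * x)) (\<lambda>_. ennreal \<bar>c\<bar>)) (A i)"
        using lborel_real_affine[OF \<open>c \<noteq> 0\<close>, of "t i"] by simp
      also have "\<dots> = ennreal \<bar>c\<bar> * emeasure lborel (?B i)"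
        using A[of i] that
        by (subst emeasure_density_const) (auto simp: emeasure_distr)
      finally show ?thesis by simp
    qed
    then have "(\<Prod>i<d. emeasure lborel (A i)) = (\<Prod>i<d. ennreal \<bar>c\<bar> * emeasure lborel (?B i))"
      by (intro prod.cong) auto
    then have "(\<Prod>i<d. emeasure lborel (A i)) = ennreal (\<bar>c\<bar> ^ d) * (\<Prod>i<d. emeasure lborel (?B i))"
      by (simp add: prod.distrib ennreal_power)
    ultimately show "emeasure ?P (PiE {..<d} A) = (\<Prod>i\<in>{..<d}. emeasure lborel (A i))"
      by (simp add: emeasure_distr)
  qed (auto simp: lebRd_def)
  then show ?thesis by (simp add: lebRd_def)
qed

lemma nn_integral_affd:
  assumes [measurable]: "g \<in> borel_measurable (lebRd d)" and c: "c \<noteq> 0"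
  shows "(\<integral>\<^sup>+x. g x \<partial>lebRd d) = ennreal (\<bar>c\<bar> ^ d) * (\<integral>\<^sup>+x. g (affd d t c x) \<partial>lebRd d)"
  by (subst distr_affd[OF c, of d t]) (simp add: nn_integral_scale_measure nn_integral_distr)

text \<open>Bridge from the topology of the full function space to \<open>lebRd\<close>: on
  \<open>Rd d\<close> the coordinates from \<open>d\<close> on are the constant
  \<open>undefined\<close>, hence measurable. It makes closed subsets measurable.\<close>

lemma measurable_id_lebRd: "(\<lambda>x. x) \<in> lebRd d \<rightarrow>\<^sub>M borel"
proof -
  have "(\<lambda>x. x) \<in> lebRd d \<rightarrow>\<^sub>M PiM UNIV (\<lambda>_. borel :: real measure)"
  proof (rule measurable_PiM_single')
    fix i :: nat
    show "(\<lambda>x. x i) \<in> borel_measurable (lebRd d)"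
    proof (cases "i < d")
      case False
      then have "x i = undefined" if "x \<in> space (lebRd d)" for x
        using that by (auto simp: Rd_def PiE_def extensional_def)
      then show ?thesis by (subst measurable_cong[where g="\<lambda>_. undefined"]) auto
    qed (rule measurable_component_lebRd)
  qed auto
  then show ?thesis
    using measurable_cong_sets[OF refl sets_PiM_equal_borel] by blast
qed

lemma closed_in_lebRd: "closed C \<Longrightarrow> C \<inter> Rd d \<in> sets (lebRd d)"
  using measurable_sets[OF measurable_id_lebRd[of d], of C] by (simp add: vimage_def Int_def)

section \<open>Symmetric convex bodies and their gauges\<close>

lemma emeasure_cube:
  assumes "0 \<le> e"
  shows "emeasure (lebRd d) (PiE {..<d} (\<lambda>_. {-e..e})) = ennreal ((2 * e) ^ d)"
  unfolding lebRd_def using assms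
  by (subst lborel_prod.emeasure_PiM) (auto simp: ennreal_power)

lemma cube_in_lebRd [measurable]: "PiE {..<d} (\<lambda>_. {-e..e}) \<in> sets (lebRd d)"
  unfolding lebRd_def by (intro sets_PiM_I_finite) auto

text \<open>Applied both to the body and to its polar, whose volumes have to be positive and finite
  before they can be cancelled.\<close>

lemma emeasure_between_cubes:
  assumes "B \<in> sets (lebRd d)" "0 < e" "0 < R"
    and "\<forall>y\<in>Rd d. (\<forall>i<d. \<bar>y i\<bar> \<le> e) \<longrightarrow> y \<in> B"
    and "\<forall>y\<in>B. \<forall>i<d. \<bar>y i\<bar> \<le> R"
  shows "0 < emeasure (lebRd d) B" "emeasure (lebRd d) B < \<infinity>"
proof -
  have *: "PiE {..<d} (\<lambda>_. {-e..e}) \<subseteq> B"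
    using assms(4) by (auto simp: Rd_def PiE_iff abs_le_iff minus_le_iff)
  have "0 < ennreal ((2 * e) ^ d)" using \<open>0 < e\<close> by simp
  also have "\<dots> \<le> emeasure (lebRd d) B"
    using emeasure_mono[OF * assms(1)] \<open>0 < e\<close> by (simp add: emeasure_cube)
  finally show "0 < emeasure (lebRd d) B" .
  have "B \<subseteq> Rd d" using sets.sets_into_space[OF assms(1)] by simp
  then have "B \<subseteq> PiE {..<d} (\<lambda>_. {-R..R})"
    using assms(5) by (auto simp: Rd_def PiE_iff abs_le_iff minus_le_iff)
  from emeasure_mono[OF this cube_in_lebRd] show "emeasure (lebRd d) B < \<infinity>"
    using \<open>0 < R\<close> by (auto simp: emeasure_cube intro: le_less_trans)
qed

lemma ipd_scld: "ipd d v (scld d c x) = c * ipd d v x"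
  by (simp add: ipd_def scld_def sum_distrib_left mult_ac)

lemma ipd_affd: "ipd d v (affd d t c x) = ipd d v t + c * ipd d v x"
  by (simp add: ipd_def affd_def sum_distrib_left sum.distrib algebra_simps)

lemma ipd_diff_left: "ipd d (\<lambda>i. t i - s i) x = ipd d t x - ipd d s x"
  by (simp add: ipd_def sum_subtractf algebra_simps)

lemma abs_ipd_le:
  assumes "\<And>i. i < d \<Longrightarrow> \<bar>v i\<bar> \<le> a" "\<And>i. i < d \<Longrightarrow> \<bar>x i\<bar> \<le> b" "0 \<le> a"
  shows "\<bar>ipd d v x\<bar> \<le> real d * (a * b)"
proof -
  have "\<bar>ipd d v x\<bar> \<le> (\<Sum>i<d. \<bar>v i * x i\<bar>)" unfolding ipd_def by (rule sum_abs)
  also have "\<dots> \<le> (\<Sum>i<d. a * b)" using assms by (intro sum_mono) (auto simp: abs_mult intro: mult_mono)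
  finally show ?thesis by simp
qed

text \<open>Positive dimension makes \<open>d\<close>-th roots meaningful; dimension zero is
  disposed of separately in \<open>SMP_transfer\<close>.\<close>

locale symmetric_body =
  fixes d :: nat and K :: "(nat \<Rightarrow> real) set"
  assumes body: "sym_convex_body d K" and d_pos: "0 < d"
begin

lemma K_subset: "K \<subseteq> Rd d"
  using body by (simp add: sym_convex_body_def)

lemma K_convex:
  assumes "x \<in> K" "y \<in> K" "0 \<le> u" "u \<le> 1"
  shows "restrict (\<lambda>i. u * x i + (1 - u) * y i) {..<d} \<in> K"
  using body assms unfolding sym_convex_body_def by blast

lemma K_midpoint:
  assumes "x \<in> K" "y \<in> K" "z \<in> Rd d" "\<And>i. i < d \<Longrightarrow> z i = (x i + y i) / 2"
  shows "z \<in> K"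
proof -
  have "z = restrict (\<lambda>i. 1/2 * x i + (1 - 1/2) * y i) {..<d}"
  proof (rule Rd_eqI[OF assms(3)])
    fix i assume "i < d"
    then show "z i = restrict (\<lambda>i. 1/2 * x i + (1 - 1/2) * y i) {..<d} i"
      using assms(4)[of i] by (simp add: add_divide_distrib)
  qed (auto simp: Rd_def)
  also have "\<dots> \<in> K" using K_convex[OF assms(1,2), of "1/2"] by simp
  finally show ?thesis .
qed

lemma K_neg: "x \<in> K \<Longrightarrow> scld d (-1) x \<in> K"
  using body unfolding sym_convex_body_def scld_def by auto

lemma K_ball: "\<exists>r>0. \<forall>y\<in>Rd d. (\<Sum>i<d. (y i)^2) < r^2 \<longrightarrow> y \<in> K"
proof -
  obtain x r where x: "x \<in> Rd d" "r > 0"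
    and B: "\<And>y. y \<in> Rd d \<Longrightarrow> (\<Sum>i<d. (y i - x i)^2) < r^2 \<Longrightarrow> y \<in> K"
    using body unfolding sym_convex_body_def by blast
  \<comment> \<open>The given ball sits at some \<open>x\<close>; symmetry moves it to the origin,
    since \<open>y\<close> is the midpoint of \<open>x + y\<close> and
    \<open>-(x - y)\<close>.\<close>
  have "y \<in> K" if y: "y \<in> Rd d" "(\<Sum>i<d. (y i)^2) < r^2" for y
  proof (rule K_midpoint[where x = "affd d x 1 y" and y = "scld d (-1) (affd d x (-1) y)"])
    show "affd d x 1 y \<in> K" using y by (intro B) (auto simp: affd_def Rd_def)
    have "affd d x (-1) y \<in> K" using y by (intro B) (auto simp: affd_def Rd_def)
    then show "scld d (-1) (affd d x (-1) y) \<in> K" by (rule K_neg)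
  qed (use y in \<open>auto simp: affd_def scld_def\<close>)
  then show ?thesis using x by blast
qed

lemma K_cube:
  obtains e where "e > 0" "\<And>y. y \<in> Rd d \<Longrightarrow> (\<And>i. i < d \<Longrightarrow> \<bar>y i\<bar> \<le> e) \<Longrightarrow> y \<in> K"
proof -
  obtain r where r: "r > 0" "\<And>y. y \<in> Rd d \<Longrightarrow> (\<Sum>i<d. (y i)^2) < r^2 \<Longrightarrow> y \<in> K"
    using K_ball by blast
  \<comment> \<open>Dividing by \<open>real d + 1\<close> makes \<open>real d * ?e^2\<close>
    strictly smaller than \<open>r^2\<close>, so the whole cube lies in the open ball.\<close>
  let ?e = "r / (real d + 1)"
  have e: "real d * ?e^2 < r^2"
  proof -
    have "real d < (real d + 1)^2" by (simp add: power2_eq_square algebra_simps add_strict_increasing)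
    then show ?thesis using r(1) by (simp add: power_divide divide_less_eq mult.commute)
  qed
  have "y \<in> K" if "y \<in> Rd d" "\<And>i. i < d \<Longrightarrow> \<bar>y i\<bar> \<le> ?e" for y
  proof (rule r(2)[OF that(1)])
    have "(\<Sum>i<d. (y i)^2) \<le> (\<Sum>i<d. ?e^2)"
      using that(2) r(1) by (intro sum_mono) (auto simp: abs_le_square_iff[symmetric])
    then show "(\<Sum>i<d. (y i)^2) < r^2" using e by simp
  qed
  then show ?thesis using that[of ?e] r(1) by auto
qed

text \<open>The point is the convex combination of \<open>x\<close> and \<open>-x\<close> with
  weight \<open>(1 + u) / 2\<close> on \<open>x\<close>.\<close>

lemma K_scld:
  assumes "x \<in> K" "\<bar>u\<bar> \<le> 1"
  shows "scld d u x \<in> K"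
proof -
  have "scld d u x = restrict (\<lambda>i. ((1 + u) / 2) * x i + (1 - (1 + u) / 2) * scld d (-1) x i) {..<d}"
    by (auto simp: scld_def fun_eq_iff field_simps)
  then show ?thesis
    using K_convex[OF assms(1) K_neg[OF assms(1)], of "(1 + u) / 2"] assms(2) by (simp add: abs_le_iff)
qed

lemma K_bound:
  obtains R where "R > 0" "\<And>x i. x \<in> K \<Longrightarrow> i < d \<Longrightarrow> \<bar>x i\<bar> \<le> R"
proof -
  have "compact ((\<lambda>x. x i) ` K)" for i
    using body unfolding sym_convex_body_def
    by (intro compact_continuous_image continuous_on_subset[OF continuous_on_product_coordinates]) auto
  then have "bounded (\<Union>i<d. (\<lambda>x. x i) ` K)"
    by (intro bounded_UN) (auto intro: compact_imp_bounded)
  then obtain R where "R > 0" "\<And>z. z \<in> (\<Union>i<d. (\<lambda>x. x i) ` K) \<Longrightarrow> norm z \<le> R"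
    unfolding bounded_pos by blast
  then show ?thesis using that[of R] by force
qed

lemma K_sets [measurable]: "K \<in> sets (lebRd d)"
proof -
  have "closed K" using body by (auto simp: sym_convex_body_def compact_imp_closed)
  moreover have "K \<inter> Rd d = K" using K_subset by auto
  ultimately show ?thesis using closed_in_lebRd[of K d] by simp
qed

lemma K_emeasure: "0 < emeasure (lebRd d) K" "emeasure (lebRd d) K < \<infinity>"
proof -
  obtain e where e: "e > 0" "\<And>y. y \<in> Rd d \<Longrightarrow> (\<And>i. i < d \<Longrightarrow> \<bar>y i\<bar> \<le> e) \<Longrightarrow> y \<in> K"
    using K_cube by blast
  obtain R where R: "R > 0" "\<And>x i. x \<in> K \<Longrightarrow> i < d \<Longrightarrow> \<bar>x i\<bar> \<le> R"
    using K_bound by blast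
  show "0 < emeasure (lebRd d) K" "emeasure (lebRd d) K < \<infinity>"
    using emeasure_between_cubes[OF K_sets e(1) R(1)] e(2) R(2) by auto
qed

lemma mink_le:
  assumes "x \<in> Rd d" "c > 0" "scld d (1 / c) x \<in> K"
  shows "mink d K x \<le> c"
  unfolding mink_def
proof (rule cInf_lower)
  have "x = restrict (\<lambda>i. c * scld d (1 / c) x i) {..<d}"
    using assms by (intro Rd_eqI[of _ d]) (auto simp: Rd_def scld_def)
  then show "c \<in> {l. 0 < l \<and> (\<exists>k\<in>K. x = restrict (\<lambda>i. l * k i) {..<d})}"
    using assms by blast
  show "bdd_below {l. 0 < l \<and> (\<exists>k\<in>K. x = restrict (\<lambda>i. l * k i) {..<d})}"
    by (rule bdd_belowI[of _ 0]) auto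
qed

lemma mink_set_nonempty:
  assumes "x \<in> Rd d"
  shows "{l. 0 < l \<and> (\<exists>k\<in>K. x = restrict (\<lambda>i. l * k i) {..<d})} \<noteq> {}"
proof -
  obtain e where e: "e > 0" "\<And>y. y \<in> Rd d \<Longrightarrow> (\<And>i. i < d \<Longrightarrow> \<bar>y i\<bar> \<le> e) \<Longrightarrow> y \<in> K"
    using K_cube by blast
  \<comment> \<open>The quotient makes the rescaled point fit into the cube; the summand 1 keeps the
    factor positive when \<open>x\<close> vanishes.\<close>
  let ?l = "(\<Sum>i<d. \<bar>x i\<bar>) / e + 1"
  have l: "?l > 0" using e(1) by (intro add_nonneg_pos divide_nonneg_pos sum_nonneg) auto
  have "scld d (1 / ?l) x \<in> K"
  proof (rule e(2))
    fix i assume i: "i < d"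
    have "\<bar>x i\<bar> \<le> (\<Sum>i<d. \<bar>x i\<bar>)" using i by (intro member_le_sum) auto
    also have "\<dots> \<le> e * ?l" using e(1) by (simp add: algebra_simps)
    finally have "\<bar>x i\<bar> / ?l \<le> e" using l by (simp add: pos_divide_le_eq)
    then show "\<bar>scld d (1 / ?l) x i\<bar> \<le> e" using i l by (simp add: scld_def abs_divide)
  qed simp
  moreover have "x = restrict (\<lambda>i. ?l * scld d (1 / ?l) x i) {..<d}"
    using assms l by (intro Rd_eqI[of _ d]) (auto simp: Rd_def scld_def)
  ultimately show ?thesis using l by blast
qed

lemma mink_nonneg: "x \<in> Rd d \<Longrightarrow> 0 \<le> mink d K x"
  unfolding mink_def by (intro cInf_greatest mink_set_nonempty) auto

text \<open>Strictness gives a member \<open>l < c\<close> of the set under the infimum, attained or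
  not, and the contraction by \<open>l / c\<close> stays in \<open>K\<close>.\<close>

lemma mink_less:
  assumes "x \<in> Rd d" "mink d K x < c"
  shows "scld d (1 / c) x \<in> K"
proof -
  obtain l k where l: "0 < l" "l < c" "k \<in> K" "x = restrict (\<lambda>i. l * k i) {..<d}"
    using cInf_lessD[OF mink_set_nonempty[OF assms(1)]] assms(2) unfolding mink_def by blast
  have "scld d (1 / c) x = scld d (l / c) k"
    using l by (auto simp: scld_def fun_eq_iff)
  then show ?thesis using K_scld[OF l(3), of "l / c"] l by simp
qed

section \<open>The polar body and its volume\<close>

definition polar :: "(nat \<Rightarrow> real) set" where
  "polar = {t \<in> Rd d. \<forall>x\<in>K. ipd d t x \<le> 1}"

lemma polar_sets [measurable]: "polar \<in> sets (lebRd d)"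
proof -
  have "closed (\<Inter>x\<in>K. {t. ipd d t x \<le> 1})"
    unfolding ipd_def
    by (intro closed_INT ballI closed_Collect_le continuous_intros continuous_on_product_coordinates)
  from closed_in_lebRd[OF this, of d] show ?thesis
    by (simp add: polar_def Int_def conj_commute)
qed

text \<open>Polarity reverses inclusions: the coordinate bound for \<open>K\<close> puts a cube
  inside \<open>polar\<close>, and the cube inside \<open>K\<close> bounds the coordinates of
  \<open>polar\<close>.\<close>

lemma polar_emeasure: "0 < emeasure (lebRd d) polar" "emeasure (lebRd d) polar < \<infinity>"
proof -
  obtain e where e: "e > 0" "\<And>y. y \<in> Rd d \<Longrightarrow> (\<And>i. i < d \<Longrightarrow> \<bar>y i\<bar> \<le> e) \<Longrightarrow> y \<in> K"
    using K_cube by blast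
  obtain R where R: "R > 0" "\<And>x i. x \<in> K \<Longrightarrow> i < d \<Longrightarrow> \<bar>x i\<bar> \<le> R"
    using K_bound by blast
  have 1: "y \<in> polar" if "y \<in> Rd d" "\<And>i. i < d \<Longrightarrow> \<bar>y i\<bar> \<le> 1 / (real d * R)" for y
  proof -
    have "ipd d y x \<le> 1" if "x \<in> K" for x
      using abs_ipd_le[of d y "1 / (real d * R)" x R] R \<open>x \<in> K\<close> that d_pos
        \<open>\<And>i. i < d \<Longrightarrow> \<bar>y i\<bar> \<le> 1 / (real d * R)\<close> by auto
    then show ?thesis using that(1) by (simp add: polar_def)
  qed
  have 2: "\<bar>y i\<bar> \<le> 1 / e" if y: "y \<in> polar" and i: "i < d" for y i
  proof -
    \<comment> \<open>Multiples of the \<open>i\<close>-th basis vector serve as test points of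
      \<open>K\<close>; taking both signs of \<open>a\<close> bounds
      \<open>\<bar>y i\<bar>\<close>.\<close>
    let ?u = "\<lambda>a. restrict (\<lambda>j. if j = i then a else 0) {..<d}"
    have "ipd d y (?u a) = y i * a" for a
    proof -
      have "ipd d y (?u a) = (\<Sum>j<d. if j = i then y i * a else 0)"
        unfolding ipd_def by (intro sum.cong) auto
      then show ?thesis using i by simp
    qed
    moreover have "?u a \<in> K" if "\<bar>a\<bar> \<le> e" for a
      using that e(1) by (intro e(2)) (auto simp: Rd_def)
    ultimately have "y i * a \<le> 1" if "\<bar>a\<bar> \<le> e" for a
      using y that by (simp add: polar_def flip: \<open>\<And>a. ipd d y (?u a) = y i * a\<close>)
    from this[of e] this[of "-e"] show ?thesis
      using e(1) by (auto simp: abs_if field_simps)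
  qed
  have "1 / (real d * R) > 0" "1 / e > 0" using d_pos R e by auto
  from emeasure_between_cubes[OF polar_sets this] 1 2
  show "0 < emeasure (lebRd d) polar" "emeasure (lebRd d) polar < \<infinity>" by auto
qed

end

section \<open>Dilation mixtures\<close>

text \<open>Layer-cake form of the exponential, used at each point to unfold the density. The
  infinite case matches the zero branch of \<open>dens_phi\<close>.\<close>

lemma nn_integral_exp_tail:
  assumes "w \<noteq> -\<infinity>"
  shows "(\<integral>\<^sup>+z. ennreal (exp (- z)) * indicator {z. w < ereal z} z \<partial>lborel) =
    (if w = \<infinity> then 0 else ennreal (exp (- real_of_ereal w)))"
proof (cases w)
  case (real c)
  have "((\<lambda>x::real. - exp (- x)) \<longlongrightarrow> - 0) at_top"
    by (intro tendsto_minus filterlim_compose[OF exp_at_bot] filterlim_uminus_at_bot_at_top)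
  then have "(\<integral>\<^sup>+z. ennreal (exp (- z)) * indicator {c..} z \<partial>lborel) = ennreal (- 0 - - exp (- c))"
    by (intro nn_integral_FTC_atLeast) (auto intro!: derivative_eq_intros)
  moreover have "(\<integral>\<^sup>+z. ennreal (exp (- z)) * indicator {z. w < ereal z} z \<partial>lborel) =
      (\<integral>\<^sup>+z. ennreal (exp (- z)) * indicator {c..} z \<partial>lborel)"
    using AE_lborel_singleton[of c] real
    by (intro nn_integral_cong_AE) (auto elim!: eventually_mono split: split_indicator)
  ultimately show ?thesis using real by simp
qed (use assms in auto)

text \<open>The radii of the superlevel sets of a log-concave radial density, as a function of
  the depth below the logarithm of its maximum; log-concavity only enters through
  star-shapedness at the origin.\<close>

definition radial_profile :: "(real \<Rightarrow> real) \<Rightarrow> bool" where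
  "radial_profile \<rho> \<longleftrightarrow> mono \<rho> \<and> (\<forall>z\<le>0. \<rho> z = 0) \<and> (\<forall>z>0. \<forall>c\<ge>1. \<rho> (c * z) \<le> c * \<rho> z)"

text \<open>For a radial profile this is the moment of order \<open>n\<close> of
  \<open>\<rho> Z\<close> with \<open>Z\<close> standard exponential: \<open>\<rho>\<close> is zero
  on the nonpositive reals and \<open>0 powr n = 0\<close>, so integrating over the whole line adds
  nothing.\<close>

definition profile_moment :: "(real \<Rightarrow> real) \<Rightarrow> real \<Rightarrow> ennreal" where
  "profile_moment \<rho> n = (\<integral>\<^sup>+z. ennreal (exp (- z) * \<rho> z powr n) \<partial>lborel)"

text \<open>A real degree covers all integrands needed: the constant 1, the range functional, and
  powers \<open>\<bar>ipd d v x\<bar> powr p\<close>.\<close>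

definition homogeneous :: "nat \<Rightarrow> real \<Rightarrow> ((nat \<Rightarrow> real) \<Rightarrow> ennreal) \<Rightarrow> bool" where
  "homogeneous d a g \<longleftrightarrow> (\<forall>x\<in>Rd d. \<forall>c>0. g (scld d c x) = ennreal (c powr a) * g x)"

lemma radial_profile_nonneg: "radial_profile \<rho> \<Longrightarrow> 0 \<le> \<rho> z"
  unfolding radial_profile_def by (metis linorder_linear monoD order_refl)

text \<open>Continuity in \<open>r\<close> turns bounds at all radii beyond and below
  \<open>\<rho>\<close> into equality, so it does not matter which boundary points a superlevel set
  contains. At \<open>\<rho> = 0\<close> the lower bound is trivial.\<close>

lemma powr_squeeze:
  fixes u v n \<rho> :: real
  assumes "0 \<le> \<rho>" "0 < n" "\<And>r. r > \<rho> \<Longrightarrow> u \<le> r powr n * v"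
    and "\<And>r. 0 < r \<Longrightarrow> r < \<rho> \<Longrightarrow> r powr n * v \<le> u" "0 \<le> u"
  shows "u = \<rho> powr n * v"
proof (rule antisym)
  have "((\<lambda>r. r powr n * v) \<longlongrightarrow> \<rho> powr n * v) (at_right \<rho>)"
    using assms by (intro tendsto_mult_right tendsto_powr')
      (auto simp: eventually_at_right_less eventually_at_filter intro!: always_eventually)
  then show "u \<le> \<rho> powr n * v"
    by (rule tendsto_lowerbound) (use assms(3) in \<open>auto simp: eventually_at_filter intro!: always_eventually\<close>)
  show "\<rho> powr n * v \<le> u"
  proof (cases "\<rho> = 0")
    case False
    then have "((\<lambda>r. r powr n * v) \<longlongrightarrow> \<rho> powr n * v) (at_left \<rho>)"
      by (intro tendsto_intros) auto
    moreover have "eventually (\<lambda>r. r powr n * v \<le> u) (at_left \<rho>)"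
      using eventually_at_left_real[of 0 \<rho>] False assms(1,4) by (auto elim!: eventually_mono)
    ultimately show ?thesis by (rule tendsto_upperbound) auto
  qed (use assms in auto)
qed

section \<open>Layer-cake formula for radial densities\<close>

context symmetric_body
begin

text \<open>The substitution by dilation gives \<open>r ^ d\<close> from the volume and
  \<open>r powr a\<close> from homogeneity.\<close>

lemma nn_integral_dilate:
  fixes a r :: real
  assumes [measurable]: "g \<in> borel_measurable (lebRd d)" and hom: "homogeneous d a g" and r: "r > 0"
  shows "(\<integral>\<^sup>+x. g x * indicator K (scld d (1 / r) x) \<partial>lebRd d) =
    ennreal (r powr (real d + a)) * (\<integral>\<^sup>+x. g x * indicator K x \<partial>lebRd d)"
proof -
  have "(\<integral>\<^sup>+x. g x * indicator K (scld d (1 / r) x) \<partial>lebRd d) =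
     ennreal (r ^ d) * (\<integral>\<^sup>+x. g (scld d r x) * indicator K (scld d (1 / r) (scld d r x)) \<partial>lebRd d)"
    using r unfolding scld_eq_affd[of d] by (subst nn_integral_affd[where c=r and t="\<lambda>_. 0"]) (auto simp flip: scld_eq_affd)
  also have "(\<integral>\<^sup>+x. g (scld d r x) * indicator K (scld d (1 / r) (scld d r x)) \<partial>lebRd d) =
     (\<integral>\<^sup>+x. ennreal (r powr a) * (g x * indicator K x) \<partial>lebRd d)"
  proof (intro nn_integral_cong)
    fix x assume "x \<in> space (lebRd d)"
    then have x: "x \<in> Rd d" by simp
    then have "scld d (1 / r) (scld d r x) = x"
      using r by (intro Rd_eqI[of _ d]) (auto simp: scld_def Rd_def)
    then show "g (scld d r x) * indicator K (scld d (1 / r) (scld d r x)) =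
       ennreal (r powr a) * (g x * indicator K x)"
      using hom x r by (simp add: homogeneous_def mult_ac)
  qed
  also have "\<dots> = ennreal (r powr a) * (\<integral>\<^sup>+x. g x * indicator K x \<partial>lebRd d)"
    by (intro nn_integral_cmult) simp
  finally show ?thesis
    using r by (simp add: powr_add powr_realpow ennreal_mult mult.assoc)
qed

lemma prob_dens_phi:
  assumes "dens_phi \<phi> d K \<in> borel_measurable (lebRd d)" "prob_space (density (lebRd d) (dens_phi \<phi> d K))"
  shows "(\<integral>\<^sup>+x. dens_phi \<phi> d K x \<partial>lebRd d) = 1"
proof -
  have "emeasure (density (lebRd d) (dens_phi \<phi> d K)) (space (lebRd d)) = 1"
    using prob_space.emeasure_space_1[OF assms(2)] by simp
  moreover have "emeasure (density (lebRd d) (dens_phi \<phi> d K)) (space (lebRd d)) =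
      (\<integral>\<^sup>+x. dens_phi \<phi> d K x * indicator (space (lebRd d)) x \<partial>lebRd d)"
    using assms(1) by (intro emeasure_density sets.top)
  moreover have "\<dots> = (\<integral>\<^sup>+x. dens_phi \<phi> d K x \<partial>lebRd d)"
    by (intro nn_integral_cong) simp
  ultimately show ?thesis by simp
qed

text \<open>The density is an integral of indicators of its superlevel sets, which up to boundary
  are the dilates of \<open>K\<close> by \<open>\<rho> z\<close>. After exchanging integrals,
  homogeneity pulls the factor \<open>\<rho> z powr (real d + a)\<close> out of each slice,
  separating the radius from the body.\<close>

lemma polar_formula:
  assumes adm: "admissible_phi \<phi>"
    and meas [measurable]: "dens_phi \<phi> d K \<in> borel_measurable (lebRd d)"
    and prob: "prob_space (density (lebRd d) (dens_phi \<phi> d K))"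
  obtains \<rho> k where "radial_profile \<rho>" "0 < k"
    "\<And>a g. 0 \<le> a \<Longrightarrow> g \<in> borel_measurable (lebRd d) \<Longrightarrow> homogeneous d a g \<Longrightarrow>
       (\<integral>\<^sup>+x. g x * indicator K x \<partial>lebRd d) < \<infinity> \<Longrightarrow>
       (\<integral>\<^sup>+x. g x \<partial>density (lebRd d) (dens_phi \<phi> d K)) =
         ennreal k * profile_moment \<rho> (real d + a) * (\<integral>\<^sup>+x. g x * indicator K x \<partial>lebRd d)"
proof -
  let ?f = "dens_phi \<phi> d K"
  have ninf: "\<phi> t \<noteq> -\<infinity>" if "0 \<le> t" for t using adm that by (simp add: admissible_phi_def)
  have le: "\<phi> s \<le> \<phi> t" if "0 \<le> s" "s \<le> t" for s t using adm that by (simp add: admissible_phi_def)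
  \<comment> \<open>Otherwise monotonicity makes the density vanish, against total mass one. Hence
    depth can be measured from the finite minimum \<open>y0\<close> of
    \<open>\<phi>\<close>.\<close>
  have "\<phi> 0 \<noteq> \<infinity>"
  proof
    assume *: "\<phi> 0 = \<infinity>"
    have "?f x = 0" if "x \<in> space (lebRd d)" for x
      using le[of 0 "mink d K x"] mink_nonneg that * by (simp add: dens_phi_def)
    then have "(\<integral>\<^sup>+x. ?f x \<partial>lebRd d) = (\<integral>\<^sup>+x. 0 \<partial>lebRd d)" by (intro nn_integral_cong)
    then show False using prob_dens_phi[OF meas prob] by simp
  qed
  then obtain y0 where y0: "\<phi> 0 = ereal y0" using ninf[of 0] by (cases "\<phi> 0") auto
  \<comment> \<open>\<open>D z\<close> holds the radii at depth less than \<open>z\<close>, and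
    \<open>L z\<close> is the superlevel set. Inserting 0 gives \<open>Sup\<close> a nonempty set
    and makes \<open>\<rho> z = 0\<close> for \<open>z \<le> 0\<close>.\<close>
  define D where "D z = {r. 0 \<le> r \<and> \<phi> r < ereal (y0 + z)}" for z
  define \<rho> where "\<rho> z = Sup (insert 0 (D z))" for z
  define L where "L z = {x. \<phi> (mink d K x) < ereal (y0 + z)}" for z
  have L_iff: "x \<in> L z \<longleftrightarrow> ennreal (exp (- (y0 + z))) < ?f x" if "x \<in> Rd d" for x z
    using ninf[OF mink_nonneg[OF that]] unfolding L_def
    by (cases "\<phi> (mink d K x)") (auto simp: dens_phi_def ennreal_less_iff)
  have inL: "x \<in> L z" if "x \<in> Rd d" "0 < r" "s \<in> D z" "r \<le> s" "scld d (1 / r) x \<in> K" for x z r s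
  proof -
    have "\<phi> (mink d K x) \<le> \<phi> s"
      using mink_le[OF that(1,2,5)] that(4) by (intro le mink_nonneg that) auto
    then show ?thesis using that(3) by (auto simp: L_def D_def)
  qed
  \<comment> \<open>Markov's inequality: on the dilate of \<open>K\<close> by
    \<open>r \<in> D z\<close> the density exceeds \<open>exp (- (y0 + z))\<close>, so total mass
    one bounds \<open>r ^ d\<close>, and \<open>r \<le> r ^ d\<close> once
    \<open>r > 1\<close>.\<close>
  have bdd: "bdd_above (insert 0 (D z))" for z
  proof -
    obtain V where V: "emeasure (lebRd d) K = ennreal V" "V > 0"
      using K_emeasure by (cases "emeasure (lebRd d) K") (auto simp: top_unique)
    let ?Q = "exp (y0 + z) / V"
    have "r \<le> max 1 ?Q" if r: "r \<in> D z" for r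
    proof (cases "r \<le> 1")
      case False
      have "ennreal (exp (- (y0 + z)) * r ^ d * V) = ennreal (exp (- (y0 + z))) * (ennreal (r powr (real d + 0)) * (\<integral>\<^sup>+x. 1 * indicator K x \<partial>lebRd d))"
        using False V by (simp add: ennreal_mult powr_realpow mult_ac)
      also have "\<dots> = (\<integral>\<^sup>+x. ennreal (exp (- (y0 + z))) * (1 * indicator K (scld d (1 / r) x)) \<partial>lebRd d)"
        using False by (subst nn_integral_dilate[symmetric]) (auto simp: homogeneous_def nn_integral_cmult)
      also have "\<dots> \<le> (\<integral>\<^sup>+x. ?f x \<partial>lebRd d)"
        using inL[OF _ _ r, of _ r] False L_iff
        by (intro nn_integral_mono) (auto split: split_indicator intro: less_imp_le)
      also have "\<dots> = 1" by (rule prob_dens_phi[OF meas prob])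
      finally have "exp (- (y0 + z)) * r ^ d * V \<le> 1" using V False by (simp flip: ennreal_1)
      then have "r ^ d \<le> ?Q" using V by (simp add: field_simps exp_diff exp_add exp_minus)
      moreover have "r ^ 1 \<le> r ^ d" using False d_pos by (intro power_increasing) auto
      ultimately show ?thesis by simp
    qed simp
    then show ?thesis by (intro bdd_aboveI[of _ "max 1 ?Q"]) auto
  qed
  have nonneg: "0 \<le> \<rho> z" for z unfolding \<rho>_def by (intro cSup_upper bdd) simp
  have upper: "r \<le> \<rho> z" if "r \<in> D z" for r z unfolding \<rho>_def using that by (intro cSup_upper bdd) simp
  have least: "\<rho> z \<le> b" if "0 \<le> b" "\<And>r. r \<in> D z \<Longrightarrow> r \<le> b" for z b
    unfolding \<rho>_def using that by (intro cSup_least) auto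
  have "radial_profile \<rho>"
    unfolding radial_profile_def
  proof (intro conjI allI impI)
    show mono: "mono \<rho>"
    proof
      fix x y :: real assume "x \<le> y"
      then have "ereal (y0 + x) \<le> ereal (y0 + y)" by simp
      then show "\<rho> x \<le> \<rho> y"
        by (intro least nonneg upper) (auto simp: D_def intro: less_le_trans simp del: ereal_less_eq)
    qed
    fix z :: real
    show "\<rho> z = 0" if "z \<le> 0"
    proof -
      have "r \<notin> D z" for r using le[of 0 r] that y0 by (cases "\<phi> r") (auto simp: D_def)
      then show ?thesis by (intro antisym least nonneg) auto
    qed
    fix c :: real assume z: "0 < z" and c: "1 \<le> c"
    show "\<rho> (c * z) \<le> c * \<rho> z"
    proof (cases "c = 1")
      case False
      then have c: "1 < c" using c by simp
      show ?thesis
      proof (rule least)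
        fix r assume r: "r \<in> D (c * z)"
        then obtain w where w: "\<phi> r = ereal w" "0 \<le> r" "w < y0 + c * z"
          using ninf[of r] by (cases "\<phi> r") (auto simp: D_def)
        \<comment> \<open>Convexity between 0 and \<open>r\<close>: at radius \<open>r / c\<close>
          the depth has dropped at least by the factor \<open>c\<close>, which is
          star-shapedness.\<close>
        have "\<phi> (1 / c * r + (1 - 1 / c) * 0) \<le> ereal (1 / c) * \<phi> r + ereal (1 - 1 / c) * \<phi> 0"
          using adm c w(2) unfolding admissible_phi_def by (metis divide_less_eq_1 less_trans order_refl zero_less_divide_1_iff zero_less_one)
        then have "\<phi> (r / c) \<le> ereal (1 / c * w + (1 - 1 / c) * y0)" using w(1) y0 by simp
        also have "1 / c * w + (1 - 1 / c) * y0 < y0 + z" using w(3) c by (simp add: field_simps)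
        finally have "r / c \<in> D z" using w c by (simp add: D_def)
        then show "r \<le> c * \<rho> z" using upper[of "r / c" z] c by (simp add: field_simps)
      qed (use c nonneg in auto)
    qed simp
  qed
  moreover have "(\<integral>\<^sup>+x. g x \<partial>density (lebRd d) ?f) =
      ennreal (exp (- y0)) * profile_moment \<rho> (real d + a) * (\<integral>\<^sup>+x. g x * indicator K x \<partial>lebRd d)"
    if a: "0 \<le> a" and [measurable]: "g \<in> borel_measurable (lebRd d)" and hom: "homogeneous d a g"
      and fin: "(\<integral>\<^sup>+x. g x * indicator K x \<partial>lebRd d) < \<infinity>" for a g
  proof -
    obtain v where v: "(\<integral>\<^sup>+x. g x * indicator K x \<partial>lebRd d) = ennreal v" "0 \<le> v"
      using fin by (cases "\<integral>\<^sup>+x. g x * indicator K x \<partial>lebRd d") (auto simp: top_unique)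
    have dil: "(\<integral>\<^sup>+x. g x * indicator K (scld d (1 / r) x) \<partial>lebRd d) = ennreal (r powr (real d + a) * v)"
      if "r > 0" for r
      using nn_integral_dilate[OF _ hom that] v by (simp add: ennreal_mult)
    \<comment> \<open>The superlevel set lies inside the dilate by every \<open>r > \<rho> z\<close>
      and contains the dilate by every positive \<open>r < \<rho> z\<close>;
      \<open>powr_squeeze\<close> closes the gap.\<close>
    have slice: "(\<integral>\<^sup>+x. g x * indicator (L z) x \<partial>lebRd d) = ennreal (\<rho> z powr (real d + a) * v)" for z
    proof -
      let ?I = "\<integral>\<^sup>+x. g x * indicator (L z) x \<partial>lebRd d"
      have up: "?I \<le> ennreal (r powr (real d + a) * v)" if r: "r > \<rho> z" for r
      proof -
        have "scld d (1 / r) x \<in> K" if "x \<in> Rd d" "x \<in> L z" for x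
        proof (rule mink_less[OF that(1)])
          have "mink d K x \<in> D z" using that mink_nonneg by (simp add: L_def D_def)
          then show "mink d K x < r" using upper r by (meson le_less_trans)
        qed
        then have "?I \<le> (\<integral>\<^sup>+x. g x * indicator K (scld d (1 / r) x) \<partial>lebRd d)"
          by (intro nn_integral_mono) (auto split: split_indicator)
        then show ?thesis using dil[of r] r nonneg[of z] by simp
      qed
      have low: "ennreal (r powr (real d + a) * v) \<le> ?I" if r: "0 < r" "r < \<rho> z" for r
      proof -
        obtain s where "s \<in> insert 0 (D z)" "r < s"
          using r(2) unfolding \<rho>_def by (meson less_cSupE insert_not_empty)
        then have s: "s \<in> D z" "r \<le> s" using r(1) by auto
        have "(\<integral>\<^sup>+x. g x * indicator K (scld d (1 / r) x) \<partial>lebRd d) \<le> ?I"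
          using inL[OF _ r(1) s] by (intro nn_integral_mono) (auto split: split_indicator)
        then show ?thesis using dil[of r] r by simp
      qed
      obtain u where u: "?I = ennreal u" "0 \<le> u"
        using up[of "\<rho> z + 1"] by (cases ?I) (auto simp: top_unique)
      have "u = \<rho> z powr (real d + a) * v"
      proof (rule powr_squeeze)
        show "u \<le> r powr (real d + a) * v" if "r > \<rho> z" for r
          using up[OF that] v(2) unfolding u(1) by (subst (asm) ennreal_le_iff) auto
        show "r powr (real d + a) * v \<le> u" if "0 < r" "r < \<rho> z" for r
          using low[OF that] u(2) unfolding u(1) by (subst (asm) ennreal_le_iff) auto
      qed (use nonneg[of z] a d_pos u(2) in auto)
      then show ?thesis using u by simp
    qed
    \<comment> \<open>Shifting the level variable by \<open>y0\<close> turns levels of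
      \<open>\<phi>\<close> into depths below the maximum and produces the factor
      \<open>exp (- y0)\<close>.\<close>
    have layer: "?f x = ennreal (exp (- y0)) * (\<integral>\<^sup>+z. ennreal (exp (- z)) * indicator (L z) x \<partial>lborel)"
      if x: "x \<in> Rd d" for x
    proof -
      have "?f x = (\<integral>\<^sup>+z. ennreal (exp (- z)) * indicator {z. \<phi> (mink d K x) < ereal z} z \<partial>lborel)"
        by (subst nn_integral_exp_tail) (use ninf mink_nonneg[OF x] in \<open>auto simp: dens_phi_def\<close>)
      also have "\<dots> = (\<integral>\<^sup>+z. ennreal (exp (- (y0 + z))) * indicator {z. \<phi> (mink d K x) < ereal z} (y0 + z) \<partial>lborel)"
        by (subst nn_integral_real_affine[where c=1 and t=y0]) auto
      also have "\<dots> = (\<integral>\<^sup>+z. ennreal (exp (- y0)) * (ennreal (exp (- z)) * indicator (L z) x) \<partial>lborel)"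
        by (intro nn_integral_cong)
          (auto simp: L_def ennreal_mult[symmetric] add.commute simp flip: exp_add split: split_indicator)
      also have "\<dots> = ennreal (exp (- y0)) * (\<integral>\<^sup>+z. ennreal (exp (- z)) * indicator (L z) x \<partial>lborel)"
        by (intro nn_integral_cmult) (auto simp: L_def)
      finally show ?thesis .
    qed
    interpret pair_sigma_finite "lebRd d" lborel
      by (intro pair_sigma_finite.intro sigma_finite_lebRd lborel.sigma_finite_measure_axioms)
    \<comment> \<open>The exchange of integrals needs joint measurability. It is obtained by writing
      membership in \<open>L z\<close> as a comparison with the measurable density.\<close>
    define h where "h x z = (if ennreal (exp (- (y0 + z))) < ?f x then 1 else 0 :: ennreal)" for x z
    have h: "indicator (L z) x = h x z" if "x \<in> Rd d" for x z
      using L_iff[OF that] by (simp add: h_def)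
    have [measurable]: "(\<lambda>(x, z). h x z) \<in> borel_measurable (lebRd d \<Otimes>\<^sub>M lborel)"
      unfolding h_def by measurable
    have [measurable]: "\<rho> \<in> borel_measurable borel"
      using \<open>radial_profile \<rho>\<close> by (intro borel_measurable_mono) (simp add: radial_profile_def)
    have "(\<integral>\<^sup>+x. g x \<partial>density (lebRd d) ?f) = (\<integral>\<^sup>+x. ?f x * g x \<partial>lebRd d)"
      by (intro nn_integral_density) auto
    also have "\<dots> = (\<integral>\<^sup>+x. \<integral>\<^sup>+z. ennreal (exp (- y0)) * (g x * (ennreal (exp (- z)) * h x z)) \<partial>lborel \<partial>lebRd d)"
    proof (intro nn_integral_cong)
      fix x assume "x \<in> space (lebRd d)"
      then have [simp]: "x \<in> Rd d" by simp
      have [measurable]: "h x \<in> borel_measurable lborel"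
        unfolding h_def by measurable
      show "?f x * g x = (\<integral>\<^sup>+z. ennreal (exp (- y0)) * (g x * (ennreal (exp (- z)) * h x z)) \<partial>lborel)"
        by (subst nn_integral_cmult, measurable, subst nn_integral_cmult, measurable)
          (simp add: layer h mult_ac)
    qed
    also have "\<dots> = (\<integral>\<^sup>+z. \<integral>\<^sup>+x. ennreal (exp (- y0)) * (g x * (ennreal (exp (- z)) * h x z)) \<partial>lebRd d \<partial>lborel)"
      by (rule Fubini'[symmetric]) simp
    also have "\<dots> = (\<integral>\<^sup>+z. ennreal (exp (- y0)) * (ennreal (exp (- z)) * (\<integral>\<^sup>+x. g x * h x z \<partial>lebRd d)) \<partial>lborel)"
    proof (intro nn_integral_cong)
      fix z
      have [measurable]: "(\<lambda>x. h x z) \<in> borel_measurable (lebRd d)" unfolding h_def by measurable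
      show "(\<integral>\<^sup>+x. ennreal (exp (- y0)) * (g x * (ennreal (exp (- z)) * h x z)) \<partial>lebRd d) =
        ennreal (exp (- y0)) * (ennreal (exp (- z)) * (\<integral>\<^sup>+x. g x * h x z \<partial>lebRd d))"
        by (subst mult.left_commute[of "g _"], subst nn_integral_cmult, measurable, subst nn_integral_cmult, measurable)
    qed
    also have "\<dots> = (\<integral>\<^sup>+z. ennreal (exp (- y0)) * (ennreal (exp (- z) * \<rho> z powr (real d + a)) * ennreal v) \<partial>lborel)"
    proof (intro nn_integral_cong)
      fix z
      have "(\<integral>\<^sup>+x. g x * h x z \<partial>lebRd d) = (\<integral>\<^sup>+x. g x * indicator (L z) x \<partial>lebRd d)"
        by (intro nn_integral_cong) (simp add: h)
      then show "ennreal (exp (- y0)) * (ennreal (exp (- z)) * (\<integral>\<^sup>+x. g x * h x z \<partial>lebRd d)) =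
          ennreal (exp (- y0)) * (ennreal (exp (- z) * \<rho> z powr (real d + a)) * ennreal v)"
        using slice[of z] v(2) by (simp add: ennreal_mult mult_ac)
    qed
    also have "\<dots> = ennreal (exp (- y0)) * profile_moment \<rho> (real d + a) * ennreal v"
      by (simp add: profile_moment_def nn_integral_cmult nn_integral_multc mult_ac)
    finally show ?thesis using v by simp
  qed
  ultimately show ?thesis using that[of \<rho> "exp (- y0)"] by simp
qed

end

section \<open>Moments of radial profiles\<close>

definition real_moment :: "(real \<Rightarrow> real) \<Rightarrow> real \<Rightarrow> real" where
  "real_moment \<rho> n = (\<integral>z. exp (- z) * \<rho> z powr n \<partial>lborel)"

text \<open>With \<open>n = d\<close> this is the \<open>p\<close>-norm of the radius
  \<open>R\<close> in the decomposition \<open>R U\<close>: dividing by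
  \<open>real_moment \<rho> n\<close> normalizes the weight
  \<open>exp (- z) * \<rho> z powr n\<close> to a probability density.\<close>

definition moment_root :: "(real \<Rightarrow> real) \<Rightarrow> real \<Rightarrow> real \<Rightarrow> real" where
  "moment_root \<rho> n p = (real_moment \<rho> (n + p) / real_moment \<rho> n) powr (1 / p)"

text \<open>Weighted AM-GM between 1 and \<open>y\<close>, by convexity of \<open>exp\<close>
  between 0 and \<open>ln y\<close>.\<close>

lemma powr_le_affine:
  fixes y \<theta> :: real
  assumes "0 < y" "0 \<le> \<theta>" "\<theta> \<le> 1"
  shows "y powr \<theta> \<le> 1 - \<theta> + \<theta> * y"
proof -
  have "exp ((1 - \<theta>) * 0 + \<theta> * ln y) \<le> (1 - \<theta>) * exp 0 + \<theta> * exp (ln y)"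
    using convex_onD[OF exp_convex, of \<theta> 0 "ln y"] assms by simp
  then show ?thesis using assms by (simp add: powr_def)
qed

lemma nn_integral_exp_scaled:
  assumes "c > 0"
  shows "(\<integral>\<^sup>+z. ennreal (exp (- (z / c))) * indicator {b..} z \<partial>lborel) = ennreal (c * exp (- (b / c)))"
proof -
  have "((\<lambda>x::real. - c * exp (- (x / c))) \<longlongrightarrow> - c * 0) at_top"
    using assms
    by (intro tendsto_mult_left filterlim_compose[OF exp_at_bot] filterlim_compose[OF filterlim_uminus_at_bot_at_top])
       (simp add: divide_inverse filterlim_at_top_mult_tendsto_pos[OF tendsto_const _ filterlim_ident])
  then have "(\<integral>\<^sup>+z. ennreal (exp (- (z / c))) * indicator {b..} z \<partial>lborel) = ennreal (- c * 0 - - c * exp (- (b / c)))"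
    using assms by (intro nn_integral_FTC_atLeast) (auto intro!: derivative_eq_intros)
  then show ?thesis by simp
qed

section \<open>Moment bounds from star-shapedness\<close>

context
  fixes \<rho> :: "real \<Rightarrow> real"
  assumes profile: "radial_profile \<rho>"
begin

lemma profile_mono: "x \<le> y \<Longrightarrow> \<rho> x \<le> \<rho> y"
  using profile by (simp add: radial_profile_def monoD)

lemma profile_nonpos: "z \<le> 0 \<Longrightarrow> \<rho> z = 0"
  using profile by (simp add: radial_profile_def)

lemma profile_star: "z > 0 \<Longrightarrow> c \<ge> 1 \<Longrightarrow> \<rho> (c * z) \<le> c * \<rho> z"
  using profile by (simp add: radial_profile_def)

lemma profile_nonneg [simp]: "0 \<le> \<rho> z"
  by (rule radial_profile_nonneg[OF profile])

lemma profile_measurable [measurable]: "\<rho> \<in> borel_measurable borel"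
  using profile by (intro borel_measurable_mono) (simp add: radial_profile_def)

text \<open>Star-shapedness gives \<open>\<rho> z \<le> \<rho> b * max 1 (z / b)\<close>. The
  maximum is at most \<open>2 * n / b * exp (z / (2 * n))\<close>, whose \<open>n\<close>-th power
  spends only half of the decay \<open>exp (- z)\<close>.\<close>

lemma profile_growth:
  assumes "b > 0" "2 * n \<ge> b" "z > 0"
  shows "exp (- z) * \<rho> z powr n \<le> (2 * n / b * \<rho> b) powr n * exp (- (z / 2))"
proof -
  have n: "n > 0" using assms by simp
  have "\<rho> z \<le> \<rho> b * max 1 (z / b)"
  proof (cases "z \<le> b")
    case True
    then have "\<rho> z \<le> \<rho> b * 1" using profile_mono by simp
    also have "\<dots> \<le> \<rho> b * max 1 (z / b)" by (intro mult_left_mono) auto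
    finally show ?thesis .
  next
    case False
    then have "\<rho> z \<le> (z / b) * \<rho> b" using profile_star[of b "z / b"] assms by simp
    also have "\<dots> \<le> \<rho> b * max 1 (z / b)"
      using mult_left_mono[of "z / b" "max 1 (z / b)" "\<rho> b"] by (simp add: mult.commute)
    finally show ?thesis .
  qed
  moreover have "max 1 (z / b) \<le> 2 * n / b * exp (z / (2 * n))"
  proof (rule max.boundedI)
    have "1 * 1 \<le> 2 * n / b * exp (z / (2 * n))" using assms n by (intro mult_mono) auto
    then show "1 \<le> 2 * n / b * exp (z / (2 * n))" by simp
    have "z / b = 2 * n / b * (z / (2 * n))" using n assms by simp
    also have "\<dots> \<le> 2 * n / b * exp (z / (2 * n))"
      using exp_ge_add_one_self[of "z / (2 * n)"] n assms
      by (intro mult_left_mono divide_nonneg_nonneg) linarith+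
    finally show "z / b \<le> 2 * n / b * exp (z / (2 * n))" .
  qed
  then have "\<rho> b * max 1 (z / b) \<le> \<rho> b * (2 * n / b * exp (z / (2 * n)))"
    by (intro mult_left_mono) auto
  ultimately have "\<rho> z \<le> (2 * n / b * \<rho> b) * exp (z / (2 * n))"
    by (simp add: mult_ac)
  then have "\<rho> z powr n \<le> ((2 * n / b * \<rho> b) * exp (z / (2 * n))) powr n"
    using n by (intro powr_mono2) auto
  also have "\<dots> = (2 * n / b * \<rho> b) powr n * exp (z / 2)"
    using n assms by (subst powr_mult) (auto simp: exp_powr_real)
  finally have "exp (- z) * \<rho> z powr n \<le> exp (- z) * ((2 * n / b * \<rho> b) powr n * exp (z / 2))"
    by (intro mult_left_mono) auto
  also have "\<dots> = (2 * n / b * \<rho> b) powr n * (exp (- z) * exp (z / 2))" by simp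
  also have "exp (- z) * exp (z / 2) = exp (- (z / 2))" by (simp flip: exp_add)
  finally show ?thesis .
qed

lemma profile_moment_upper:
  assumes "b > 0" "2 * n \<ge> b"
  shows "profile_moment \<rho> n \<le> ennreal (2 * (2 * n / b * \<rho> b) powr n)"
proof -
  have "profile_moment \<rho> n \<le>
      (\<integral>\<^sup>+z. ennreal ((2 * n / b * \<rho> b) powr n) * (ennreal (exp (- (z / 2))) * indicator {0..} z) \<partial>lborel)"
    unfolding profile_moment_def
  proof (intro nn_integral_mono)
    fix z :: real
    show "ennreal (exp (- z) * \<rho> z powr n) \<le>
        ennreal ((2 * n / b * \<rho> b) powr n) * (ennreal (exp (- (z / 2))) * indicator {0..} z)"
      using profile_growth[OF assms, of z] profile_nonpos[of z]
      by (cases "z > 0") (auto simp: ennreal_mult[symmetric] ennreal_leI)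
  qed
  also have "\<dots> = ennreal ((2 * n / b * \<rho> b) powr n) * ennreal (2 * exp (- (0 / 2)))"
    by (subst nn_integral_cmult) (auto simp: nn_integral_exp_scaled[of 2 0])
  finally show ?thesis by (simp add: ennreal_mult mult.commute)
qed

lemma integrable_moment:
  assumes "n > 0"
  shows "integrable lborel (\<lambda>z. exp (- z) * \<rho> z powr n)"
proof (rule integrableI_nonneg)
  have "profile_moment \<rho> n < \<infinity>"
    using profile_moment_upper[of "2 * n" n] assms by (auto intro: le_less_trans)
  then show "(\<integral>\<^sup>+z. ennreal (exp (- z) * \<rho> z powr n) \<partial>lborel) < \<infinity>"
    by (simp add: profile_moment_def)
qed auto

lemma profile_moment_eq: "n > 0 \<Longrightarrow> profile_moment \<rho> n = ennreal (real_moment \<rho> n)"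
  unfolding profile_moment_def real_moment_def
  by (intro nn_integral_eq_integral integrable_moment) auto

lemma real_moment_nonneg [simp]: "0 \<le> real_moment \<rho> n"
  unfolding real_moment_def by (intro integral_nonneg_AE) auto

lemma real_moment_upper:
  assumes "b > 0" "2 * n \<ge> b"
  shows "real_moment \<rho> n \<le> 2 * (2 * n / b * \<rho> b) powr n"
  using profile_moment_upper[OF assms] assms by (simp add: profile_moment_eq)

text \<open>Beyond \<open>b\<close> the profile is at least \<open>\<rho> b\<close>, and the
  exponential law gives that tail mass \<open>exp (- b)\<close>.\<close>

lemma real_moment_lower:
  assumes "n > 0"
  shows "exp (- b) * \<rho> b powr n \<le> real_moment \<rho> n"
proof -
  have "ennreal (exp (- b) * \<rho> b powr n) = ennreal (\<rho> b powr n) * (\<integral>\<^sup>+z. ennreal (exp (- (z / 1))) * indicator {b..} z \<partial>lborel)"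
    by (subst nn_integral_exp_scaled) (auto simp: ennreal_mult[symmetric] mult.commute)
  also have "\<dots> = (\<integral>\<^sup>+z. ennreal (\<rho> b powr n) * (ennreal (exp (- (z / 1))) * indicator {b..} z) \<partial>lborel)"
    by (intro nn_integral_cmult[symmetric]) auto
  also have "\<dots> \<le> profile_moment \<rho> n"
    unfolding profile_moment_def using assms profile_mono
    by (intro nn_integral_mono) (auto simp: ennreal_mult[symmetric] mult.commute intro!: ennreal_leI mult_left_mono powr_mono2 split: split_indicator)
  finally show ?thesis using assms by (simp add: profile_moment_eq)
qed

lemma real_moment_pos:
  assumes "n > 0" "\<rho> b > 0"
  shows "real_moment \<rho> n > 0"
  using real_moment_lower[OF assms(1), of b] assms by (auto intro: less_le_trans[rotated])

lemma moment_root_pos: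
  assumes "n > 0" "p > 0" "\<rho> b > 0"
  shows "moment_root \<rho> n p > 0"
  using real_moment_pos[of n b] real_moment_pos[of "n + p" b] assms by (simp add: moment_root_def)

lemma moment_root_powr:
  assumes "n > 0" "p > 0"
  shows "moment_root \<rho> n p powr p = real_moment \<rho> (n + p) / real_moment \<rho> n"
  using assms by (simp add: moment_root_def powr_powr)

text \<open>Monotonicity of \<open>p\<close>-norms under the weight
  \<open>exp (- z) * \<rho> z powr n\<close>. Normalizing by the larger norm \<open>c\<close>, it
  follows by integrating \<open>powr_le_affine\<close> for \<open>(\<rho> z / c) powr q\<close> with
  exponent \<open>p / q\<close>.\<close>

lemma moment_root_mono:
  assumes "n > 0" "p > 0" "p \<le> q" "\<rho> b > 0"
  shows "moment_root \<rho> n p \<le> moment_root \<rho> n q"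
proof -
  define c where "c = moment_root \<rho> n q"
  define \<theta> where "\<theta> = p / q"
  have c: "c > 0" unfolding c_def using assms by (intro moment_root_pos) auto
  have \<theta>: "0 \<le> \<theta>" "\<theta> \<le> 1" "q * \<theta> = p" using assms by (auto simp: \<theta>_def)
  have M: "real_moment \<rho> n > 0" using assms real_moment_pos by blast
  have pw: "\<rho> z powr (n + p) \<le> c powr p * ((1 - \<theta>) * \<rho> z powr n + \<theta> * (\<rho> z powr (n + q) / c powr q))" for z
  proof (cases "\<rho> z = 0")
    case False
    then have r: "\<rho> z > 0" using profile_nonneg[of z] by linarith
    have "(\<rho> z / c) powr p = ((\<rho> z / c) powr q) powr \<theta>" using \<theta>(3) by (simp add: powr_powr)
    also have "\<dots> \<le> 1 - \<theta> + \<theta> * (\<rho> z / c) powr q" using r c \<theta> by (intro powr_le_affine) auto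
    finally have "\<rho> z powr p \<le> c powr p * (1 - \<theta> + \<theta> * (\<rho> z powr q / c powr q))"
      using c r by (simp add: powr_divide divide_le_eq mult.commute)
    then have "\<rho> z powr n * \<rho> z powr p \<le> \<rho> z powr n * (c powr p * (1 - \<theta> + \<theta> * (\<rho> z powr q / c powr q)))"
      by (intro mult_left_mono) auto
    then show ?thesis using r by (simp add: powr_add algebra_simps)
  qed (use \<theta> in auto)
  have 1: "integrable lborel (\<lambda>z. (1 - \<theta>) * (exp (- z) * \<rho> z powr n))"
    and 2: "integrable lborel (\<lambda>z. \<theta> / c powr q * (exp (- z) * \<rho> z powr (n + q)))"
    using assms by (intro integrable_mult_right integrable_moment; simp)+
  have "real_moment \<rho> (n + p) \<le> (\<integral>z. c powr p * ((1 - \<theta>) * (exp (- z) * \<rho> z powr n) + \<theta> / c powr q * (exp (- z) * \<rho> z powr (n + q))) \<partial>lborel)"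
    unfolding real_moment_def
  proof (intro integral_mono)
    fix z
    have "exp (- z) * \<rho> z powr (n + p) \<le> exp (- z) * (c powr p * ((1 - \<theta>) * \<rho> z powr n + \<theta> * (\<rho> z powr (n + q) / c powr q)))"
      by (intro mult_left_mono pw) auto
    then show "exp (- z) * \<rho> z powr (n + p) \<le> c powr p * ((1 - \<theta>) * (exp (- z) * \<rho> z powr n) + \<theta> / c powr q * (exp (- z) * \<rho> z powr (n + q)))"
      by (simp add: algebra_simps)
    show "integrable lborel (\<lambda>z. exp (- z) * \<rho> z powr (n + p))"
      using assms by (intro integrable_moment) simp
    show "integrable lborel (\<lambda>z. c powr p * ((1 - \<theta>) * (exp (- z) * \<rho> z powr n) + \<theta> / c powr q * (exp (- z) * \<rho> z powr (n + q))))"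
      by (intro integrable_mult_right Bochner_Integration.integrable_add 1 2)
  qed
  also have "\<dots> = c powr p * ((1 - \<theta>) * real_moment \<rho> n + \<theta> / c powr q * real_moment \<rho> (n + q))"
    unfolding real_moment_def
    by (simp only: integral_mult_right_zero Bochner_Integration.integral_add[OF 1 2])
  also have "real_moment \<rho> (n + q) = c powr q * real_moment \<rho> n"
    unfolding c_def using assms M by (subst moment_root_powr) auto
  also have "c powr p * ((1 - \<theta>) * real_moment \<rho> n + \<theta> / c powr q * (c powr q * real_moment \<rho> n)) = c powr p * real_moment \<rho> n"
    using c by (simp add: algebra_simps)
  finally have "real_moment \<rho> (n + p) / real_moment \<rho> n \<le> c powr p" using M by (simp add: divide_le_eq)
  then have "(real_moment \<rho> (n + p) / real_moment \<rho> n) powr (1 / p) \<le> (c powr p) powr (1 / p)"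
    using assms by (intro powr_mono2) auto
  then show ?thesis using assms c by (simp add: powr_powr c_def[symmetric] moment_root_def[of \<rho> n p])
qed

text \<open>The part of the weighted mass with radius below \<open>t\<close> is at most half of the
  total, so the mean radius is at least \<open>t / 2\<close>.\<close>

lemma moment_root_1_lower:
  assumes "d \<ge> 1" "\<rho> d > 0"
  shows "\<rho> d / (4 * exp 1) \<le> moment_root \<rho> d 1"
proof -
  \<comment> \<open>The divisor \<open>exp 1\<close> matches the loss \<open>exp (- d)\<close> in
    \<open>real_moment_lower\<close> at \<open>b = d\<close>; the extra 2 makes
    \<open>t powr d\<close> at most half of \<open>real_moment \<rho> d\<close>.\<close>
  define t where "t = \<rho> d / (2 * exp 1)"
  have t: "t > 0" using assms by (simp add: t_def)
  have M: "real_moment \<rho> d > 0" using assms real_moment_pos[of d d] by simp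
  have pw: "t * \<rho> z powr d \<le> \<rho> z powr (d + 1) + t powr (d + 1)" for z
  proof (cases "\<rho> z \<ge> t")
    case True
    then have "t * \<rho> z powr d \<le> \<rho> z * \<rho> z powr d" by (intro mult_right_mono) auto
    also have "\<dots> = \<rho> z powr (d + 1)" using True t by (simp add: powr_add)
    finally show ?thesis by (simp add: add_increasing2)
  next
    case False
    then have "t * \<rho> z powr d \<le> t * t powr d" using t assms by (intro mult_left_mono powr_mono2) auto
    then show ?thesis using t by (simp add: powr_add add_increasing)
  qed
  have "ennreal (t * real_moment \<rho> d) = ennreal t * profile_moment \<rho> d"
    using assms t by (simp add: profile_moment_eq ennreal_mult)
  also have "\<dots> = (\<integral>\<^sup>+z. ennreal t * ennreal (exp (- z) * \<rho> z powr d) \<partial>lborel)"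
    unfolding profile_moment_def by (intro nn_integral_cmult[symmetric]) auto
  \<comment> \<open>The constant term is cut to the half-line to keep its integral finite; for
    \<open>z \<le> 0\<close> the left side is zero because the profile vanishes.\<close>
  also have "\<dots> \<le> (\<integral>\<^sup>+z. ennreal (exp (- z) * \<rho> z powr (d + 1)) + ennreal (t powr (d + 1)) * (ennreal (exp (- (z / 1))) * indicator {0..} z) \<partial>lborel)"
  proof (intro nn_integral_mono)
    fix z :: real
    show "ennreal t * ennreal (exp (- z) * \<rho> z powr d) \<le> ennreal (exp (- z) * \<rho> z powr (d + 1)) + ennreal (t powr (d + 1)) * (ennreal (exp (- (z / 1))) * indicator {0..} z)"
    proof (cases "z > 0")
      case True
      have "exp (- z) * (t * \<rho> z powr d) \<le> exp (- z) * (\<rho> z powr (d + 1) + t powr (d + 1))"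
        by (intro mult_left_mono pw) auto
      then have "t * (exp (- z) * \<rho> z powr d) \<le> exp (- z) * \<rho> z powr (d + 1) + t powr (d + 1) * exp (- z)"
        by (simp add: algebra_simps)
      then show ?thesis using True t
        by (simp add: ennreal_mult[symmetric] ennreal_plus[symmetric] del: ennreal_plus)
    qed (simp add: profile_nonpos)
  qed
  also have "\<dots> = profile_moment \<rho> (d + 1) + ennreal (t powr (d + 1)) * ennreal (1 * exp (- (0 / 1)))"
    unfolding profile_moment_def
    by (subst nn_integral_add) (auto simp: nn_integral_cmult nn_integral_exp_scaled[of 1 0, simplified])
  also have "\<dots> = ennreal (real_moment \<rho> (d + 1) + t powr (d + 1))"
    using assms by (simp add: profile_moment_eq ennreal_plus)
  finally have *: "t * real_moment \<rho> d \<le> real_moment \<rho> (d + 1) + t powr (d + 1)"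
    by (subst (asm) ennreal_le_iff) auto
  have "t powr d = (1/2) powr d * (exp (- d) * \<rho> d powr d)"
    unfolding t_def using assms by (simp add: powr_divide powr_mult exp_powr_real exp_minus field_simps)
  also have "\<dots> \<le> (1/2) powr 1 * real_moment \<rho> d"
    using assms by (intro mult_mono real_moment_lower powr_mono') auto
  finally have "t * t powr d \<le> t * (1/2 * real_moment \<rho> d)" using t by (intro mult_left_mono) auto
  moreover have "t powr (d + 1) = t * t powr d" using t by (simp add: powr_add)
  moreover have "t * (1/2 * real_moment \<rho> d) = t / 2 * real_moment \<rho> d"
    "t * real_moment \<rho> d = 2 * (t / 2 * real_moment \<rho> d)" by simp_all
  ultimately have "t / 2 * real_moment \<rho> d \<le> real_moment \<rho> (d + 1)"
    using * by linarith
  then have "t / 2 \<le> real_moment \<rho> (d + 1) / real_moment \<rho> d" using M by (simp add: le_divide_eq)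
  then show ?thesis by (simp add: moment_root_def t_def)
qed

text \<open>The numerator is bounded above and the denominator below at the same point
  \<open>d\<close> of the profile. After the \<open>p\<close>-th root only a multiple of
  \<open>(1 + p / d)\<^sup>2 * \<rho> d\<close> remains, and the mean radius controls
  \<open>\<rho> d\<close>.\<close>

lemma moment_root_upper:
  assumes "d \<ge> 1" "\<rho> d > 0" "p \<ge> d"
  shows "moment_root \<rho> d p \<le> 32 * (exp 1)\<^sup>2 * (1 + p / d)\<^sup>2 * moment_root \<rho> d 1"
proof -
  define m where "m = 1 + p / d"
  have m: "m \<ge> 2" "2 * (d + p) / d = 2 * m" using assms by (auto simp: m_def field_simps)
  have M: "real_moment \<rho> d > 0" using assms real_moment_pos[of d d] by simp
  have "real_moment \<rho> (d + p) \<le> 2 * (2 * m * \<rho> d) powr (d + p)"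
    using real_moment_upper[of d "d + p", unfolded m(2)] assms by simp
  also have "\<dots> = (2 * exp d * (2 * m) powr (d + p) * \<rho> d powr p) * (exp (- d) * \<rho> d powr d)"
    using assms m by (simp add: powr_mult powr_add exp_minus field_simps)
  \<comment> \<open>Since \<open>1 \<le> d \<le> p\<close>, the factors 2 and \<open>exp d\<close>
    and the exponent \<open>d + p\<close> are absorbed into \<open>p\<close>-th powers, with
    \<open>d + p \<le> 2 * p\<close>; this is the source of the square.\<close>
  also have "\<dots> \<le> (2 powr p * exp p * (2 * m) powr (2 * p) * \<rho> d powr p) * real_moment \<rho> d"
  proof -
    have "2 \<le> (2::real) powr p" using assms powr_mono[of 1 p 2] by simp
    then have "2 * exp d * (2 * m) powr (d + p) \<le> 2 powr p * exp p * (2 * m) powr (2 * p)"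
      using assms m by (intro mult_mono powr_mono) auto
    then have "2 * exp d * (2 * m) powr (d + p) * \<rho> d powr p \<le> 2 powr p * exp p * (2 * m) powr (2 * p) * \<rho> d powr p"
      by (rule mult_right_mono) simp
    from mult_mono[OF this real_moment_lower] show ?thesis
      using assms by simp
  qed
  also have "2 powr p * exp p * (2 * m) powr (2 * p) * \<rho> d powr p = (8 * exp 1 * m\<^sup>2 * \<rho> d) powr p"
  proof -
    have "(2 * m) powr (2 * p) = ((2 * m)\<^sup>2) powr p"
      using m by (simp add: powr_powr[symmetric])
    moreover have "8 * exp 1 * m\<^sup>2 * \<rho> d = 2 * exp 1 * (2 * m)\<^sup>2 * \<rho> d" by (simp add: power2_eq_square)
    ultimately show ?thesis using m by (simp only: powr_mult) (simp add: powr_mult exp_powr_real)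
  qed
  finally have "real_moment \<rho> (d + p) / real_moment \<rho> d \<le> (8 * exp 1 * m\<^sup>2 * \<rho> d) powr p"
    using M by (simp add: divide_le_eq)
  then have "moment_root \<rho> d p \<le> ((8 * exp 1 * m\<^sup>2 * \<rho> d) powr p) powr (1 / p)"
    unfolding moment_root_def using assms by (intro powr_mono2) auto
  also have "\<dots> = 8 * exp 1 * m\<^sup>2 * \<rho> d" using assms m by (simp add: powr_powr)
  also have "\<dots> = 32 * (exp 1)\<^sup>2 * m\<^sup>2 * (\<rho> d / (4 * exp 1))" by (simp add: power2_eq_square)
  also have "\<dots> \<le> 32 * (exp 1)\<^sup>2 * m\<^sup>2 * moment_root \<rho> d 1"
    using moment_root_1_lower[OF assms(1,2)] by (intro mult_left_mono) auto
  finally show ?thesis by (simp add: m_def)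
qed

end

section \<open>The uniform distribution on a symmetric convex body\<close>

context symmetric_body
begin

definition vol :: real where
  "vol = measure (lebRd d) K"

lemma emeasure_K: "emeasure (lebRd d) K = ennreal vol"
  using K_emeasure unfolding vol_def by (intro emeasure_eq_ennreal_measure) auto

lemma vol_pos: "0 < vol"
  using K_emeasure emeasure_K by simp

lemma nn_integral_K_const: "(\<integral>\<^sup>+x. c * indicator K x \<partial>lebRd d) = c * ennreal vol"
  by (simp add: nn_integral_cmult emeasure_K)

lemma ipd_bounded:
  obtains B where "0 \<le> B" "\<And>x. x \<in> K \<Longrightarrow> \<bar>ipd d v x\<bar> \<le> B"
proof -
  obtain R where R: "R > 0" "\<And>x i. x \<in> K \<Longrightarrow> i < d \<Longrightarrow> \<bar>x i\<bar> \<le> R"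
    using K_bound by blast
  let ?a = "\<Sum>i<d. \<bar>v i\<bar>"
  have a: "\<bar>v i\<bar> \<le> ?a" if "i < d" for i using that by (intro member_le_sum) auto
  have a0: "0 \<le> ?a" by (intro sum_nonneg) auto
  show ?thesis
  proof (rule that)
    show "0 \<le> real d * (?a * R)" using a0 R(1) by simp
    show "\<bar>ipd d v x\<bar> \<le> real d * (?a * R)" if "x \<in> K" for x
      using a R(2)[OF that] a0 by (intro abs_ipd_le) auto
  qed
qed

text \<open>The \<open>p\<close>-norm of the pairing of \<open>v\<close> with a uniform vector on
  \<open>K\<close>. For \<open>p > 0\<close> the integral is finite, so \<open>enn2real\<close>
  keeps its value.\<close>

definition unif_moment :: "real \<Rightarrow> (nat \<Rightarrow> real) \<Rightarrow> real" where
  "unif_moment p v =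
    (enn2real (\<integral>\<^sup>+x. ennreal (\<bar>ipd d v x\<bar> powr p) * indicator K x \<partial>lebRd d) / vol) powr (1 / p)"

definition range_on :: "(nat \<Rightarrow> real) set \<Rightarrow> (nat \<Rightarrow> real) \<Rightarrow> ennreal" where
  "range_on T x = (SUP ts\<in>T \<times> T. ennreal (ipd d (\<lambda>i. fst ts i - snd ts i) x))"

text \<open>The expected range under the uniform law. \<open>enn2real\<close> would send an infinite
  integral to 0; finiteness is established for finite \<open>T\<close>, to which the argument is
  reduced.\<close>

definition unif_range :: "(nat \<Rightarrow> real) set \<Rightarrow> real" where
  "unif_range T = enn2real (\<integral>\<^sup>+x. range_on T x * indicator K x \<partial>lebRd d) / vol"

lemma moment_integral_le:
  assumes "\<And>x. x \<in> K \<Longrightarrow> \<bar>ipd d v x\<bar> \<le> h" "0 \<le> h" "0 < p"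
  shows "(\<integral>\<^sup>+x. ennreal (\<bar>ipd d v x\<bar> powr p) * indicator K x \<partial>lebRd d) \<le> ennreal (h powr p * vol)"
proof -
  have "(\<integral>\<^sup>+x. ennreal (\<bar>ipd d v x\<bar> powr p) * indicator K x \<partial>lebRd d) \<le>
      (\<integral>\<^sup>+x. ennreal (h powr p) * indicator K x \<partial>lebRd d)"
    using assms by (intro nn_integral_mono) (auto intro!: ennreal_leI powr_mono2 split: split_indicator)
  then show ?thesis using vol_pos by (simp add: nn_integral_K_const ennreal_mult)
qed

lemma moment_integral_finite:
  assumes "0 < p"
  shows "(\<integral>\<^sup>+x. ennreal (\<bar>ipd d v x\<bar> powr p) * indicator K x \<partial>lebRd d) < \<infinity>"
proof -
  obtain B where "0 \<le> B" "\<And>x. x \<in> K \<Longrightarrow> \<bar>ipd d v x\<bar> \<le> B" using ipd_bounded by blast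
  from moment_integral_le[OF this(2,1) assms] show ?thesis by (auto intro: le_less_trans)
qed

lemma unif_moment_upper:
  assumes "\<And>x. x \<in> K \<Longrightarrow> \<bar>ipd d v x\<bar> \<le> h" "0 \<le> h" "0 < p"
  shows "unif_moment p v \<le> h"
proof -
  let ?W = "enn2real (\<integral>\<^sup>+x. ennreal (\<bar>ipd d v x\<bar> powr p) * indicator K x \<partial>lebRd d)"
  have "?W \<le> h powr p * vol"
    using moment_integral_le[OF assms] vol_pos by (intro enn2real_leI) auto
  then have "?W / vol \<le> h powr p" using vol_pos by (simp add: divide_le_eq)
  then have "unif_moment p v \<le> (h powr p) powr (1 / p)"
    unfolding unif_moment_def using assms(3) vol_pos by (intro powr_mono2) auto
  also have "\<dots> = h" using assms by (simp add: powr_powr)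
  finally show ?thesis .
qed

text \<open>Restrict to the half-size copy of the body centred at half the given point; by symmetry,
  on half of that copy the functional is at least half its value at the point.\<close>

lemma unif_moment_lower:
  assumes x0: "x0 \<in> K"
  shows "\<bar>ipd d v x0\<bar> / 8 \<le> unif_moment (real d) v"
proof -
  \<comment> \<open>At the midpoint of \<open>x0\<close> and \<open>x\<close> the functional takes
    the value \<open>a + ipd d v x / 2\<close>.\<close>
  define a where "a = ipd d v x0 / 2"
  let ?F = "\<lambda>y. ennreal (\<bar>y\<bar> powr real d)"
  let ?W = "\<integral>\<^sup>+x. ?F (ipd d v x) * indicator K x \<partial>lebRd d"
  let ?J = "\<lambda>s. \<integral>\<^sup>+x. ?F (a + s * ipd d v x / 2) * indicator K x \<partial>lebRd d"
  have ipd_half: "ipd d v (\<lambda>i. x0 i / 2) = a"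
    by (simp add: a_def ipd_def sum_divide_distrib)
  have W_eq: "?W = ennreal ((1/2) ^ d) * (\<integral>\<^sup>+x. ?F (ipd d v (affd d (\<lambda>i. x0 i / 2) (1/2) x)) *
      indicator K (affd d (\<lambda>i. x0 i / 2) (1/2) x) \<partial>lebRd d)"
    by (subst nn_integral_affd[where c = "1/2" and t = "\<lambda>i. x0 i / 2"]) auto
  have J_le: "(\<integral>\<^sup>+x. ?F (ipd d v (affd d (\<lambda>i. x0 i / 2) (1/2) x)) *
      indicator K (affd d (\<lambda>i. x0 i / 2) (1/2) x) \<partial>lebRd d) \<ge> ?J 1"
  proof (intro nn_integral_mono)
    fix x
    have "affd d (\<lambda>i. x0 i / 2) (1/2) x \<in> K" if "x \<in> K"
      by (rule K_midpoint[OF x0 that]) (auto simp: affd_def Rd_def)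
    then show "?F (a + 1 * ipd d v x / 2) * indicator K x \<le>
        ?F (ipd d v (affd d (\<lambda>i. x0 i / 2) (1/2) x)) * indicator K (affd d (\<lambda>i. x0 i / 2) (1/2) x)"
      by (auto simp: ipd_affd ipd_half split: split_indicator)
  qed
  have W: "ennreal ((1/2) ^ d) * ?J 1 \<le> ?W"
    by (subst W_eq) (rule mult_left_mono[OF J_le], simp)
  \<comment> \<open>Reflection through the origin preserves \<open>K\<close> and Lebesgue measure
    and flips the sign of the functional.\<close>
  have "?J 1 = (\<integral>\<^sup>+x. ?F (a + ipd d v (scld d (-1) x) / 2) * indicator K (scld d (-1) x) \<partial>lebRd d)"
    unfolding scld_eq_affd[of d] by (subst nn_integral_affd[where c = "-1" and t = "\<lambda>_. 0"]) auto
  also have "\<dots> = ?J (-1)"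
  proof (intro nn_integral_cong)
    fix x assume "x \<in> space (lebRd d)"
    then have "scld d (-1) (scld d (-1) x) = x"
      by (intro Rd_eqI[of _ d]) (auto simp: scld_def Rd_def)
    then have "scld d (-1) x \<in> K \<longleftrightarrow> x \<in> K" using K_neg by metis
    then show "?F (a + ipd d v (scld d (-1) x) / 2) * indicator K (scld d (-1) x) =
        ?F (a + -1 * ipd d v x / 2) * indicator K x"
      by (auto simp: ipd_scld split: split_indicator)
  qed
  finally have J: "?J 1 = ?J (-1)" .
  have "?F a * ennreal vol = (\<integral>\<^sup>+x. ?F a * indicator K x \<partial>lebRd d)"
    by (simp add: nn_integral_K_const)
  also have "\<dots> \<le> (\<integral>\<^sup>+x. ?F (a + 1 * ipd d v x / 2) * indicator K x + ?F (a + -1 * ipd d v x / 2) * indicator K x \<partial>lebRd d)"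
  proof (intro nn_integral_mono)
    fix x
    let ?b = "ipd d v x / 2"
    \<comment> \<open>One of the two signs always increases the modulus; averaging over both signs
      costs a factor 2.\<close>
    have "\<bar>a\<bar> \<le> \<bar>a + ?b\<bar> \<or> \<bar>a\<bar> \<le> \<bar>a - ?b\<bar>" by linarith
    then have "?F a \<le> ?F (a + ?b) \<or> ?F a \<le> ?F (a - ?b)"
      by (auto intro!: ennreal_leI powr_mono2)
    then have "?F a \<le> ?F (a + ?b) + ?F (a - ?b)"
      by (meson add_increasing add_increasing2 zero_le)
    then show "?F a * indicator K x \<le> ?F (a + 1 * ipd d v x / 2) * indicator K x + ?F (a + -1 * ipd d v x / 2) * indicator K x"
      by (auto split: split_indicator)
  qed
  also have "\<dots> = ?J 1 + ?J (-1)" by (intro nn_integral_add) auto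
  also have "\<dots> = 2 * ?J 1" unfolding J by (rule mult_2[symmetric])
  finally have "ennreal ((1/2) ^ d) * (?F a * ennreal vol) \<le> ennreal ((1/2) ^ d) * (2 * ?J 1)"
    by (rule mult_left_mono) simp
  also have "\<dots> = 2 * (ennreal ((1/2) ^ d) * ?J 1)" by (rule mult.left_commute)
  also have "\<dots> \<le> 2 * ?W" using W by (rule mult_left_mono) simp
  also have "?W = ennreal (enn2real ?W)" using moment_integral_finite[of d v] d_pos by simp
  also have "2 * \<dots> = ennreal (2 * enn2real ?W)" by (simp add: ennreal_mult)
  also have "ennreal ((1/2) ^ d) * (?F a * ennreal vol) = ennreal ((1/2) ^ d * (\<bar>a\<bar> powr real d * vol))"
    using vol_pos by (simp add: ennreal_mult)
  finally have "(1/2) ^ d * (\<bar>a\<bar> powr real d * vol) \<le> 2 * enn2real ?W"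
    by (subst (asm) ennreal_le_iff) auto
  then have *: "(1/2) ^ d * \<bar>a\<bar> powr real d / 2 \<le> enn2real ?W / vol"
    using vol_pos by (simp add: le_divide_eq mult_ac)
  \<comment> \<open>One factor \<open>(1/2) ^ d\<close> is the volume of the half-size copy, the
    other dominates the sign factor 1/2. With \<open>a\<close> half the value at \<open>x0\<close>
    this gives the constant 8.\<close>
  have "(\<bar>a\<bar> / 4) powr real d = (1/2) ^ d * \<bar>a\<bar> powr real d * (1/2) ^ d"
    by (simp add: powr_divide powr_realpow power_divide flip: power_mult_distrib)
  also have "\<dots> \<le> (1/2) ^ d * \<bar>a\<bar> powr real d * (1/2) ^ 1"
    using d_pos by (intro mult_left_mono power_decreasing) auto
  also have "\<dots> \<le> enn2real ?W / vol" using * by simp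
  finally have "((\<bar>a\<bar> / 4) powr real d) powr (1 / real d) \<le> unif_moment (real d) v"
    unfolding unif_moment_def by (intro powr_mono2) auto
  then show ?thesis using d_pos by (simp add: powr_powr a_def)
qed

section \<open>The range functional of a finite set\<close>

lemma range_on_measurable:
  assumes "finite T"
  shows "range_on T \<in> borel_measurable (lebRd d)"
  unfolding range_on_def[abs_def] using assms
  by (intro borel_measurable_SUP) (auto intro: countable_finite)

lemma range_on_mono: "S \<subseteq> T \<Longrightarrow> range_on S x \<le> range_on T x"
  unfolding range_on_def by (intro SUP_subset_mono) auto

lemma range_integral_finite:
  assumes "finite T"
  shows "(\<integral>\<^sup>+x. range_on T x * indicator K x \<partial>lebRd d) < \<infinity>"
proof -
  have "\<exists>B. \<forall>x\<in>K. ipd d (\<lambda>i. fst ts i - snd ts i) x \<le> B" for ts :: "(nat \<Rightarrow> real) \<times> (nat \<Rightarrow> real)"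
    using ipd_bounded[of "\<lambda>i. fst ts i - snd ts i"] by (metis abs_le_D1)
  then obtain B where B: "\<And>ts x. x \<in> K \<Longrightarrow> ipd d (\<lambda>i. fst ts i - snd ts i) x \<le> B ts"
    by metis
  let ?C = "\<Sum>ts\<in>T \<times> T. \<bar>B ts\<bar>"
  have "range_on T x \<le> ennreal ?C" if "x \<in> K" for x
    unfolding range_on_def
  proof (rule SUP_least)
    fix ts assume "ts \<in> T \<times> T"
    then have "\<bar>B ts\<bar> \<le> ?C" using assms by (intro member_le_sum) auto
    then show "ennreal (ipd d (\<lambda>i. fst ts i - snd ts i) x) \<le> ennreal ?C"
      using B[OF that, of ts] by (intro ennreal_leI) linarith
  qed
  then have "(\<integral>\<^sup>+x. range_on T x * indicator K x \<partial>lebRd d) \<le> (\<integral>\<^sup>+x. ennreal ?C * indicator K x \<partial>lebRd d)"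
    by (intro nn_integral_mono) (auto split: split_indicator)
  also have "\<dots> < \<infinity>" by (simp add: nn_integral_K_const ennreal_mult_less_top)
  finally show ?thesis .
qed

lemma unif_range_mono:
  assumes "S \<subseteq> T" "finite T"
  shows "unif_range S \<le> unif_range T"
  unfolding unif_range_def using assms range_integral_finite[OF assms(2)] vol_pos
  by (intro divide_right_mono enn2real_mono nn_integral_mono)
     (auto intro: range_on_mono split: split_indicator)

lemma unif_range_nonneg: "0 \<le> unif_range T"
  using vol_pos by (simp add: unif_range_def)

section \<open>Volume packing in the polar norm\<close>

definition ball_at :: "(nat \<Rightarrow> real) \<Rightarrow> real \<Rightarrow> (nat \<Rightarrow> real) set" where
  "ball_at t r = affd d (\<lambda>i. - (t i / r)) (1 / r) -` polar \<inter> Rd d"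

text \<open>The set is a closed ball about \<open>t\<close> in the norm whose unit ball is
  \<open>polar\<close>, encoded as an affine preimage so that measurability is inherited. The
  one-sided polar condition becomes two-sided because \<open>K\<close> is symmetric.\<close>

lemma ball_at_iff:
  assumes "r > 0"
  shows "y \<in> ball_at t r \<longleftrightarrow> y \<in> Rd d \<and> (\<forall>x\<in>K. \<bar>ipd d (\<lambda>i. y i - t i) x\<bar> \<le> r)"
proof -
  have *: "ipd d (affd d (\<lambda>i. - (t i / r)) (1 / r) y) x = ipd d (\<lambda>i. y i - t i) x / r" for x
    using assms by (simp add: ipd_def affd_def sum_divide_distrib field_simps)
  have "\<bar>ipd d (\<lambda>i. y i - t i) x\<bar> \<le> r" if "x \<in> K" "\<forall>x\<in>K. ipd d (\<lambda>i. y i - t i) x \<le> r" for x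
    using that(2)[rule_format, OF that(1)] that(2)[rule_format, OF K_neg[OF that(1)]]
    by (simp add: ipd_scld)
  then show ?thesis
    using assms by (auto simp: ball_at_def polar_def * divide_le_eq dest: abs_le_D1)
qed

lemma ball_at_sets [measurable]: "ball_at t r \<in> sets (lebRd d)"
  unfolding ball_at_def using measurable_sets[OF measurable_affd polar_sets] by simp

lemma emeasure_ball_at:
  assumes "r > 0"
  shows "emeasure (lebRd d) (ball_at t r) = ennreal (r ^ d) * emeasure (lebRd d) polar"
proof -
  have "emeasure (lebRd d) (ball_at t r) = (\<integral>\<^sup>+x. indicator (ball_at t r) x \<partial>lebRd d)" by simp
  also have "\<dots> = ennreal (r ^ d) * (\<integral>\<^sup>+x. indicator (ball_at t r) (affd d t r x) \<partial>lebRd d)"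
    using assms by (subst nn_integral_affd[where c = r and t = t]) auto
  also have "(\<integral>\<^sup>+x. indicator (ball_at t r) (affd d t r x) \<partial>lebRd d) = (\<integral>\<^sup>+x. indicator polar x \<partial>lebRd d)"
  proof (intro nn_integral_cong)
    fix x assume "x \<in> space (lebRd d)"
    then have "affd d (\<lambda>i. - (t i / r)) (1 / r) (affd d t r x) = x"
      using assms by (intro Rd_eqI[of _ d]) (auto simp: affd_def Rd_def field_simps)
    then show "indicator (ball_at t r) (affd d t r x) = (indicator polar x :: ennreal)"
      by (simp add: ball_at_def indicator_def)
  qed
  finally show ?thesis by simp
qed

text \<open>Separation in the norm dual to \<open>K\<close>, phrased through a witness in
  \<open>K\<close> instead of a supremum.\<close>

definition separated :: "real \<Rightarrow> (nat \<Rightarrow> real) set \<Rightarrow> bool" where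
  "separated B S \<longleftrightarrow> (\<forall>s\<in>S. \<forall>t\<in>S. s \<noteq> t \<longrightarrow> (\<exists>x\<in>K. B \<le> \<bar>ipd d (\<lambda>i. t i - s i) x\<bar>))"

lemma abs_ipd_diff_commute: "\<bar>ipd d (\<lambda>i. t i - s i) x\<bar> = \<bar>ipd d (\<lambda>i. s i - t i) x\<bar>"
  by (simp add: ipd_diff_left abs_minus_commute)

text \<open>By maximality of the \<open>B\<close>-separated subset \<open>S\<close>, every point of
  \<open>T\<close> is within \<open>B\<close> of \<open>S\<close>. Disjoint small balls about
  \<open>T\<close> then lie in balls of radius \<open>B + r\<close> about \<open>S\<close>, and the
  volumes are compared.\<close>

lemma packing:
  assumes T: "finite T" "T \<subseteq> Rd d" "separated \<delta> T" and \<delta>: "\<delta> > 0" and B: "B > 0"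
  obtains S where "S \<subseteq> T" "separated B S" "real (card T) \<le> real (card S) * (1 + 3 * B / \<delta>) ^ d"
proof -
  have "finite {S. S \<subseteq> T \<and> separated B S}" "{} \<in> {S. S \<subseteq> T \<and> separated B S}"
    using T(1) by (auto simp: separated_def)
  from finite_has_maximal2[OF this]
  obtain S where S: "S \<subseteq> T" "separated B S" and max: "\<And>S'. S' \<subseteq> T \<Longrightarrow> separated B S' \<Longrightarrow> S \<subseteq> S' \<Longrightarrow> S = S'"
    by auto
  have finS: "finite S" using S(1) T(1) by (rule finite_subset)
  \<comment> \<open>Closed balls of radius \<open>\<delta> / 3\<close> about
    \<open>\<delta>\<close>-separated points are disjoint because
    \<open>2 * \<delta> / 3 < \<delta>\<close>.\<close>
  define r where "r = \<delta> / 3"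
  have r: "r > 0" using \<delta> by (simp add: r_def)
  have near: "\<exists>s\<in>S. \<forall>x\<in>K. \<bar>ipd d (\<lambda>i. t i - s i) x\<bar> < B" if t: "t \<in> T" for t
  proof (cases "t \<in> S")
    case True
    then show ?thesis using B by (intro bexI[of _ t]) (auto simp: ipd_def)
  next
    case False
    then have "\<not> separated B (insert t S)" using max[of "insert t S"] S(1) t by blast
    then show ?thesis
      using S(2) unfolding separated_def
      by (auto simp: not_le) (use abs_ipd_diff_commute in metis)+
  qed
  have disj: "disjoint_family_on (\<lambda>t. ball_at t r) T"
    unfolding disjoint_family_on_def
  proof (intro ballI impI, rule ccontr)
    fix s t assume st: "s \<in> T" "t \<in> T" "s \<noteq> t" and "ball_at s r \<inter> ball_at t r \<noteq> {}"
    then obtain y where y: "y \<in> ball_at s r" "y \<in> ball_at t r" by auto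
    obtain x where x: "x \<in> K" "\<delta> \<le> \<bar>ipd d (\<lambda>i. t i - s i) x\<bar>"
      using T(3) st unfolding separated_def by blast
    have "\<bar>ipd d (\<lambda>i. y i - s i) x\<bar> \<le> r" "\<bar>ipd d (\<lambda>i. y i - t i) x\<bar> \<le> r"
      using y x(1) r by (auto simp: ball_at_iff)
    then show False using x(2) \<delta> unfolding r_def ipd_diff_left by linarith
  qed
  have cover: "(\<Union>t\<in>T. ball_at t r) \<subseteq> (\<Union>s\<in>S. ball_at s (B + r))"
  proof
    fix y assume "y \<in> (\<Union>t\<in>T. ball_at t r)"
    then obtain t where t: "t \<in> T" "y \<in> ball_at t r" by auto
    obtain s where s: "s \<in> S" "\<forall>x\<in>K. \<bar>ipd d (\<lambda>i. t i - s i) x\<bar> < B" using near[OF t(1)] by blast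
    have "\<bar>ipd d (\<lambda>i. y i - s i) x\<bar> \<le> B + r" if "x \<in> K" for x
    proof -
      have "\<bar>ipd d (\<lambda>i. y i - t i) x\<bar> \<le> r" "\<bar>ipd d (\<lambda>i. t i - s i) x\<bar> < B"
        using t(2) s(2) that r by (auto simp: ball_at_iff)
      then show ?thesis unfolding ipd_diff_left by linarith
    qed
    then have "y \<in> ball_at s (B + r)" using t(2) r B by (simp add: ball_at_iff)
    then show "y \<in> (\<Union>s\<in>S. ball_at s (B + r))" using s(1) by blast
  qed
  obtain P where P: "emeasure (lebRd d) polar = ennreal P" "P > 0"
    using polar_emeasure by (cases "emeasure (lebRd d) polar") (auto simp: top_unique)
  have "ennreal (real (card T) * (r ^ d * P)) = (\<Sum>t\<in>T. emeasure (lebRd d) (ball_at t r))"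
    using r P by (simp add: emeasure_ball_at ennreal_mult ennreal_of_nat_eq_real_of_nat)
  also have "\<dots> = emeasure (lebRd d) (\<Union>t\<in>T. ball_at t r)"
    using disj T(1) by (intro sum_emeasure) auto
  also have "\<dots> \<le> emeasure (lebRd d) (\<Union>s\<in>S. ball_at s (B + r))"
    using cover finS by (intro emeasure_mono) auto
  also have "\<dots> \<le> (\<Sum>s\<in>S. emeasure (lebRd d) (ball_at s (B + r)))"
    using finS by (intro emeasure_subadditive_finite) auto
  also have "\<dots> = ennreal (real (card S) * ((B + r) ^ d * P))"
    using r B P by (simp add: emeasure_ball_at ennreal_mult ennreal_of_nat_eq_real_of_nat)
  finally have "real (card T) * (r ^ d * P) \<le> real (card S) * ((B + r) ^ d * P)"
    using r B P by (subst (asm) ennreal_le_iff) auto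
  then have "real (card T) \<le> real (card S) * ((B + r) / r) ^ d"
    using r P by (simp add: power_divide le_divide_eq)
  also have "(B + r) / r = 1 + 3 * B / \<delta>" using \<delta> by (simp add: r_def field_simps)
  finally show ?thesis using that[OF S] by simp
qed

end

section \<open>Transfer of the minoration principle\<close>

context symmetric_body
begin

lemma homogeneous_moment: "homogeneous d p (\<lambda>x. ennreal (\<bar>ipd d v x\<bar> powr p))"
  unfolding homogeneous_def by (auto simp: ipd_scld abs_mult powr_mult ennreal_mult)

lemma homogeneous_range_on: "homogeneous d 1 (range_on T)"
  unfolding homogeneous_def range_on_def
  by (auto simp: ipd_scld ennreal_mult' SUP_mult_left_ennreal)

text \<open>\<open>polar_formula\<close> for the constant 1 fixes the normalization; for powers of
  linear functionals and for the range it then factors each integral into a norm of the radius times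
  a uniform quantity.\<close>

lemma radial_law:
  assumes adm: "admissible_phi \<phi>"
    and meas: "dens_phi \<phi> d K \<in> borel_measurable (lebRd d)"
    and prob: "prob_space (density (lebRd d) (dens_phi \<phi> d K))"
  obtains \<rho> where "radial_profile \<rho>" "\<rho> (real d) > 0"
    "\<And>p v. p \<ge> 1 \<Longrightarrow> lp_norm (density (lebRd d) (dens_phi \<phi> d K)) (ipd d v) p =
       ennreal (moment_root \<rho> d p * unif_moment p v)"
    "\<And>T. finite T \<Longrightarrow> (\<integral>\<^sup>+x. range_on T x \<partial>density (lebRd d) (dens_phi \<phi> d K)) =
       ennreal (moment_root \<rho> d 1 * unif_range T)"
proof -
  let ?\<mu> = "density (lebRd d) (dens_phi \<phi> d K)"
  obtain \<rho> k where \<rho>: "radial_profile \<rho>" and k: "0 < k"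
    and pol: "\<And>a g. 0 \<le> a \<Longrightarrow> g \<in> borel_measurable (lebRd d) \<Longrightarrow> homogeneous d a g \<Longrightarrow>
       (\<integral>\<^sup>+x. g x * indicator K x \<partial>lebRd d) < \<infinity> \<Longrightarrow>
       (\<integral>\<^sup>+x. g x \<partial>?\<mu>) = ennreal k * profile_moment \<rho> (real d + a) * (\<integral>\<^sup>+x. g x * indicator K x \<partial>lebRd d)"
    using polar_formula[OF assms] by blast
  let ?M = "real_moment \<rho>"
  have "1 = emeasure ?\<mu> (space ?\<mu>)" using prob_space.emeasure_space_1[OF prob] by simp
  also have "\<dots> = (\<integral>\<^sup>+x. 1 \<partial>?\<mu>)" by simp
  also have "\<dots> = ennreal k * profile_moment \<rho> (real d + 0) * (\<integral>\<^sup>+x. 1 * indicator K x \<partial>lebRd d)"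
    by (intro pol) (auto simp: homogeneous_def emeasure_K)
  also have "\<dots> = ennreal (k * ?M d * vol)"
    using k vol_pos d_pos by (simp add: nn_integral_K_const emeasure_K profile_moment_eq[OF \<rho>] ennreal_mult real_moment_nonneg[OF \<rho>])
  finally have one: "k * ?M d * vol = 1"
    by (metis ennreal_1 ennreal_eq_1 )
  then have M: "?M d > 0" using real_moment_nonneg[OF \<rho>, of d] by (cases "?M d = 0") auto
  \<comment> \<open>If \<open>\<rho> d\<close> were 0, the upper moment bound with
    \<open>b = n = d\<close> would make \<open>real_moment \<rho> d\<close> zero.\<close>
  have "\<rho> d \<noteq> 0"
    using real_moment_upper[OF \<rho>, of d d] M d_pos by auto
  then have pos: "\<rho> d > 0" using radial_profile_nonneg[OF \<rho>, of d] by linarith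
  have k_eq: "k = 1 / (?M d * vol)" using one M vol_pos by (simp add: field_simps)
  have lp: "lp_norm ?\<mu> (ipd d v) p = ennreal (moment_root \<rho> d p * unif_moment p v)" if "p \<ge> 1" for p v
  proof -
    let ?W = "\<integral>\<^sup>+x. ennreal (\<bar>ipd d v x\<bar> powr p) * indicator K x \<partial>lebRd d"
    have fin: "?W < \<infinity>" using that by (intro moment_integral_finite) simp
    have "(\<integral>\<^sup>+x. ennreal (\<bar>ipd d v x\<bar> powr p) \<partial>?\<mu>) = ennreal k * profile_moment \<rho> (d + p) * ?W"
      using that fin by (intro pol homogeneous_moment) auto
    also have "?W = ennreal (enn2real ?W)" using fin by simp
    also have "ennreal k * profile_moment \<rho> (d + p) * \<dots> = ennreal (?M (d + p) / ?M d * (enn2real ?W / vol))"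
      using k that by (simp add: profile_moment_eq[OF \<rho>] ennreal_mult[symmetric] real_moment_nonneg[OF \<rho>])
        (simp add: k_eq)
    finally show ?thesis
      using M vol_pos real_moment_nonneg[OF \<rho>, of "d + p"]
      by (simp add: lp_norm_def moment_root_def unif_moment_def powr_mult del: times_divide_eq_left times_divide_eq_right)
  qed
  have rg: "(\<integral>\<^sup>+x. range_on T x \<partial>?\<mu>) = ennreal (moment_root \<rho> d 1 * unif_range T)" if "finite T" for T
  proof -
    let ?S = "\<integral>\<^sup>+x. range_on T x * indicator K x \<partial>lebRd d"
    have fin: "?S < \<infinity>" using that by (rule range_integral_finite)
    have "(\<integral>\<^sup>+x. range_on T x \<partial>?\<mu>) = ennreal k * profile_moment \<rho> (real d + 1) * ?S"
      using that fin by (intro pol homogeneous_range_on range_on_measurable) auto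
    also have "?S = ennreal (enn2real ?S)" using fin by simp
    also have "ennreal k * profile_moment \<rho> (real d + 1) * \<dots> = ennreal (?M (real d + 1) / ?M d * (enn2real ?S / vol))"
      using k by (simp add: profile_moment_eq[OF \<rho>] ennreal_mult[symmetric] real_moment_nonneg[OF \<rho>])
        (simp add: k_eq)
    finally show ?thesis
      using M by (simp add: moment_root_def unif_range_def real_moment_nonneg[OF \<rho>])
  qed
  show ?thesis using that[OF \<rho> pos lp rg] .
qed

text \<open>A separation \<open>w\<close> for the uniform vector becomes \<open>R * w\<close> for
  the first vector, with \<open>R\<close> the \<open>p\<close>-norm of its radius. The expected
  range gains only the mean radius, which is at most \<open>R\<close>, so \<open>R\<close> cancels
  and \<open>\<kappa>\<close> survives.\<close>

lemma unif_minoration: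
  assumes adm: "admissible_phi \<phi>"
    and meas: "dens_phi \<phi> d K \<in> borel_measurable (lebRd d)"
    and prob: "prob_space (density (lebRd d) (dens_phi \<phi> d K))"
    and smp: "SMP d (density (lebRd d) (dens_phi \<phi> d K)) \<kappa>" and \<kappa>: "\<kappa> > 0"
    and T: "finite T" "T \<subseteq> Rd d" "exp p \<le> real (card T)" and p: "p \<ge> 1" and w: "w > 0"
    and sep: "\<And>s t. s \<in> T \<Longrightarrow> t \<in> T \<Longrightarrow> s \<noteq> t \<Longrightarrow> w \<le> unif_moment p (\<lambda>i. t i - s i)"
  shows "\<kappa> * w \<le> unif_range T"
proof -
  let ?\<mu> = "density (lebRd d) (dens_phi \<phi> d K)"
  obtain \<rho> where \<rho>: "radial_profile \<rho>" "\<rho> (real d) > 0"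
    and lp: "\<And>p v. p \<ge> 1 \<Longrightarrow> lp_norm ?\<mu> (ipd d v) p = ennreal (moment_root \<rho> d p * unif_moment p v)"
    and rg: "\<And>T. finite T \<Longrightarrow> (\<integral>\<^sup>+x. range_on T x \<partial>?\<mu>) = ennreal (moment_root \<rho> d 1 * unif_range T)"
    using radial_law[OF adm meas prob] by blast
  define R where "R = moment_root \<rho> d p"
  have R: "R > 0" "moment_root \<rho> d 1 \<le> R"
    unfolding R_def using \<rho> d_pos p by (auto intro!: moment_root_pos moment_root_mono)
  have "ennreal (R * w) \<le> lp_norm ?\<mu> (\<lambda>x. ipd d (\<lambda>i. t i - s i) x) p" if "s \<in> T" "t \<in> T" "s \<noteq> t" for s t
    using lp[OF p, of "\<lambda>i. t i - s i"] sep[OF that] R by (simp add: R_def[symmetric] ennreal_leI)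
  moreover have "SMP_p d ?\<mu> p \<kappa>" using smp p by (simp add: SMP_def)
  ultimately have "ennreal (\<kappa> * (R * w)) \<le> (\<integral>\<^sup>+x. range_on T x \<partial>?\<mu>)"
    unfolding range_on_def SMP_p_def using T R w by (auto elim!: allE[of _ "R * w"] allE[of _ T])
  also have "\<dots> = ennreal (moment_root \<rho> d 1 * unif_range T)" using T(1) by (rule rg)
  also have "\<dots> \<le> ennreal (R * unif_range T)"
    using R unif_range_nonneg by (intro ennreal_leI mult_right_mono)
  finally have "R * (\<kappa> * w) \<le> R * unif_range T"
    using R unif_range_nonneg[of T] by (subst (asm) ennreal_le_iff) (auto simp: mult_ac)
  then show ?thesis using R by simp
qed

text \<open>Beyond exponent \<open>2 d\<close> the radial factor grows polynomially in \<open>p / d\<close>, whereas a volume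
  count leaves \<open>exp d\<close> of the points separated at a scale larger by \<open>exp (p / d)\<close>.\<close>

lemma minoration_transfer:
  assumes \<rho>: "radial_profile \<rho>" "\<rho> (real d) > 0" and \<kappa>: "\<kappa> > 0"
    and unif: "\<And>S p w. finite S \<Longrightarrow> S \<subseteq> Rd d \<Longrightarrow> exp p \<le> real (card S) \<Longrightarrow> 1 \<le> p \<Longrightarrow> 0 < w \<Longrightarrow>
      (\<And>s t. s \<in> S \<Longrightarrow> t \<in> S \<Longrightarrow> s \<noteq> t \<Longrightarrow> w \<le> unif_moment p (\<lambda>i. t i - s i)) \<Longrightarrow>
      \<kappa> * w \<le> unif_range S"
    and T: "finite T" "T \<subseteq> Rd d" "exp p \<le> real (card T)" and p: "p \<ge> 1" and A: "A > 0"
    and sep: "\<And>s t. s \<in> T \<Longrightarrow> t \<in> T \<Longrightarrow> s \<noteq> t \<Longrightarrow> A \<le> moment_root \<rho> d p * unif_moment p (\<lambda>i. t i - s i)"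
  shows "\<kappa> * A \<le> 6144 * exp 1 ^ 3 * (moment_root \<rho> d 1 * unif_range T)"
proof -
  have d: "real d \<ge> 1" using d_pos by simp
  define R where "R = moment_root \<rho> d p"
  define R1 where "R1 = moment_root \<rho> d 1"
  have R: "R > 0" "R1 > 0" unfolding R_def R1_def using \<rho> d_pos p by (auto intro!: moment_root_pos)
  have sep': "A / R \<le> unif_moment p (\<lambda>i. t i - s i)" if "s \<in> T" "t \<in> T" "s \<noteq> t" for s t
    using sep[OF that] R by (simp add: R_def divide_le_eq mult.commute)
  have U: "0 \<le> R1 * unif_range T" using R unif_range_nonneg by simp
  have e1: "1 \<le> exp (1::real)" by simp
  show ?thesis
  proof (cases "p \<le> 2 * real d")
    case True
    \<comment> \<open>Up to exponent \<open>2 d\<close> the radial loss is bounded, since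
      \<open>1 + 2 * d / d = 3\<close>, and the minoration applies to \<open>T\<close>
      itself.\<close>
    have "R \<le> moment_root \<rho> d (2 * real d)"
      unfolding R_def using \<rho> d p True by (intro moment_root_mono) auto
    also have "\<dots> \<le> 32 * (exp 1)\<^sup>2 * (1 + 2 * real d / d)\<^sup>2 * R1"
      unfolding R1_def using \<rho> d by (intro moment_root_upper) auto
    also have "\<dots> = 288 * (exp 1)\<^sup>2 * R1" using d_pos by simp
    finally have R_le: "R \<le> 288 * (exp 1)\<^sup>2 * R1" .
    have "\<kappa> * (A / R) \<le> unif_range T"
      using A R sep' by (intro unif[OF T p]) auto
    then have "\<kappa> * A \<le> R * unif_range T" using R by (simp add: divide_le_eq mult.commute)
    also have "\<dots> \<le> 288 * (exp 1)\<^sup>2 * R1 * unif_range T"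
      using R_le unif_range_nonneg by (rule mult_right_mono)
    also have "\<dots> = 288 * (exp 1)\<^sup>2 * (R1 * unif_range T)" by simp
    also have "\<dots> \<le> 6144 * exp 1 ^ 3 * (R1 * unif_range T)"
      using U e1 by (intro mult_right_mono mult_mono power_increasing) auto
    finally show ?thesis by (simp add: R1_def)
  next
    case False
    define q where "q = p / d"
    have q: "q \<ge> 2" "p = q * d" using False d_pos by (auto simp: q_def field_simps)
    \<comment> \<open>Halving makes the contradiction with \<open>sep'\<close> strict.
      \<open>B\<close> is chosen so that \<open>1 + 3 * B / \<delta> = exp (q - 1)\<close>: packing
      divides \<open>exp p\<close> by \<open>exp (p - d)\<close> and leaves \<open>exp d\<close>
      points.\<close>
    define \<delta> where "\<delta> = A / R / 2"
    define B where "B = \<delta> * (exp (q - 1) - 1) / 3"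
    have \<delta>: "\<delta> > 0" using A R by (simp add: \<delta>_def)
    \<comment> \<open>As \<open>q \<ge> 2\<close>, subtracting 1 removes at most half of
      \<open>exp (q - 1)\<close>, so \<open>B\<close> really is of order
      \<open>\<delta> * exp (q - 1)\<close>.\<close>
    have "exp (1::real) \<ge> 2" using exp_ge_add_one_self[of "1::real"] by simp
    moreover have "exp 1 \<le> exp (q - 1)" using q by simp
    ultimately have eq2: "exp (q - 1) / 2 \<le> exp (q - 1) - 1" "exp (q - 1) - 1 > 0" by linarith+
    have B: "B > 0" using \<delta> eq2 by (simp add: B_def)
    have "separated \<delta> T"
      unfolding separated_def
    proof (intro ballI impI, rule ccontr)
      fix s t assume st: "s \<in> T" "t \<in> T" "s \<noteq> t" "\<not> (\<exists>x\<in>K. \<delta> \<le> \<bar>ipd d (\<lambda>i. t i - s i) x\<bar>)"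
      then have "unif_moment p (\<lambda>i. t i - s i) \<le> \<delta>"
        using \<delta> p by (intro unif_moment_upper) auto
      then show False using sep'[OF st(1-3)] \<delta> by (simp add: \<delta>_def)
    qed
    from packing[OF T(1,2) this \<delta> B] obtain S where S: "S \<subseteq> T" "separated B S"
      and card: "real (card T) \<le> real (card S) * (1 + 3 * B / \<delta>) ^ d" by blast
    have "1 + 3 * B / \<delta> = exp (q - 1)" using \<delta> by (simp add: B_def)
    then have "exp p \<le> real (card S) * exp (q - 1) ^ d" using card T(3) by simp
    also have "exp (q - 1) ^ d = exp (p - d)"
      by (simp add: exp_of_nat_mult[symmetric] q(2) algebra_simps)
    finally have "exp (real d) * exp (p - d) \<le> real (card S) * exp (p - d)"
      by (simp flip: exp_add)
    then have card_S: "exp (real d) \<le> real (card S)" by simp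
    have "B / 8 \<le> unif_moment d (\<lambda>i. t i - s i)" if st: "s \<in> S" "t \<in> S" "s \<noteq> t" for s t
    proof -
      obtain x where "x \<in> K" "B \<le> \<bar>ipd d (\<lambda>i. t i - s i) x\<bar>"
        using S(2) st unfolding separated_def by blast
      then show ?thesis using unif_moment_lower[of x "\<lambda>i. t i - s i"] by simp
    qed
    then have "\<kappa> * (B / 8) \<le> unif_range S"
      using S(1) T B d by (intro unif[OF _ _ card_S]) (auto intro: finite_subset)
    also have "\<dots> \<le> unif_range T" using S(1) T(1) by (rule unif_range_mono)
    finally have "\<kappa> * B \<le> 8 * unif_range T" by simp
    moreover have "\<kappa> * (\<delta> * (exp (q - 1) / 2) / 3) \<le> \<kappa> * B"
      unfolding B_def using \<kappa> \<delta> eq2 by (intro mult_left_mono divide_right_mono) auto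
    ultimately have "\<kappa> * (\<delta> * (exp (q - 1) / 2) / 3) \<le> 8 * unif_range T" by linarith
    then have "\<kappa> * A * exp q \<le> 96 * exp 1 * (R * unif_range T)"
      using R by (simp add: \<delta>_def exp_diff field_simps)
    also have "R \<le> 32 * (exp 1)\<^sup>2 * (1 + q)\<^sup>2 * R1"
      unfolding R_def R1_def q_def using \<rho> d False by (intro moment_root_upper) auto
    \<comment> \<open>The polynomial radial loss is absorbed by the gain \<open>exp q\<close>, via
      the quadratic Taylor bound. The constant is \<open>96 * 32 * 2 = 6144\<close>.\<close>
    also have "(1 + q)\<^sup>2 \<le> 2 * exp q"
      using exp_lower_Taylor_quadratic[of q] q by (simp add: power2_eq_square algebra_simps)
    finally have "\<kappa> * A * exp q \<le> 96 * exp 1 * (32 * (exp 1)\<^sup>2 * (2 * exp q) * R1 * unif_range T)"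
      using R unif_range_nonneg[of T] by (simp add: mult_left_mono mult_right_mono)
    also have "\<dots> = (6144 * exp 1 ^ 3 * (R1 * unif_range T)) * exp q"
      by (simp add: power2_eq_square power3_eq_cube)
    finally show ?thesis by (simp add: R1_def)
  qed
qed

end

text \<open>After reduction to a finite set in positive dimension, the first vector enters only
  through minoration for the uniform law, and the second only through its radial moments.\<close>

lemma SMP_transfer:
  assumes body: "sym_convex_body d K"
    and adm: "admissible_phi \<phi>1" "admissible_phi \<phi>2"
    and meas: "dens_phi \<phi>1 d K \<in> borel_measurable (lebRd d)" "dens_phi \<phi>2 d K \<in> borel_measurable (lebRd d)"
    and prob: "prob_space (density (lebRd d) (dens_phi \<phi>1 d K))" "prob_space (density (lebRd d) (dens_phi \<phi>2 d K))"
    and \<kappa>: "\<kappa> > 0" and smp: "SMP d (density (lebRd d) (dens_phi \<phi>1 d K)) \<kappa>"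
  shows "SMP d (density (lebRd d) (dens_phi \<phi>2 d K)) (\<kappa> / (6144 * exp 1 ^ 3))"
  unfolding SMP_def SMP_p_def
proof (intro allI impI, elim conjE)
  let ?\<mu> = "density (lebRd d) (dens_phi \<phi>2 d K)"
  fix p A :: real and T :: "(nat \<Rightarrow> real) set"
  assume p: "1 \<le> p" and A: "0 < A" and T: "T \<subseteq> Rd d" "infinite T \<or> exp p \<le> real (card T)"
    and sep: "\<forall>s\<in>T. \<forall>t\<in>T. s \<noteq> t \<longrightarrow> ennreal A \<le> lp_norm ?\<mu> (\<lambda>x. ipd d (\<lambda>i. t i - s i) x) p"
  \<comment> \<open>An infinite set is replaced by a finite subset that still has
    \<open>exp p\<close> points; separation is inherited and the range only decreases.\<close>
  obtain T' where T': "T' \<subseteq> T" "finite T'" "exp p \<le> real (card T')"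
  proof (cases "finite T")
    case False
    obtain n where n: "exp p \<le> real n" using real_arch_simple by blast
    obtain T' where "finite T'" "card T' = n" "T' \<subseteq> T" using infinite_arbitrarily_large[OF False] by blast
    then show ?thesis using that n by auto
  qed (use T that in auto)
  \<comment> \<open>In dimension zero the space is a single point, whereas \<open>exp p > 1\<close>
    demands at least two.\<close>
  have "d \<noteq> 0"
  proof
    assume "d = 0"
    then have "T' \<subseteq> {\<lambda>_. undefined}" using T T' by (auto simp: Rd_def)
    then have "card T' \<le> 1" using card_mono[of "{\<lambda>_. undefined}" T'] by simp
    moreover have "exp p > 1" using p by simp
    ultimately show False using T'(3) by linarith
  qed
  then interpret symmetric_body d K by unfold_locales (auto intro: body)
  obtain \<rho> where \<rho>: "radial_profile \<rho>" "\<rho> (real d) > 0"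
    and lp: "\<And>p v. p \<ge> 1 \<Longrightarrow> lp_norm ?\<mu> (ipd d v) p = ennreal (moment_root \<rho> d p * unif_moment p v)"
    and rg: "\<And>T. finite T \<Longrightarrow> (\<integral>\<^sup>+x. range_on T x \<partial>?\<mu>) = ennreal (moment_root \<rho> d 1 * unif_range T)"
    using radial_law[OF adm(2) meas(2) prob(2)] by blast
  have "A \<le> moment_root \<rho> d p * unif_moment p (\<lambda>i. t i - s i)" if "s \<in> T'" "t \<in> T'" "s \<noteq> t" for s t
  proof -
    have "ennreal A \<le> ennreal (moment_root \<rho> d p * unif_moment p (\<lambda>i. t i - s i))"
      using sep that T'(1) lp[OF p, of "\<lambda>i. t i - s i"] by (metis subsetD)
    then show ?thesis using A
      by (subst (asm) ennreal_le_iff) (auto simp: moment_root_def unif_moment_def)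
  qed
  then have "\<kappa> * A \<le> 6144 * exp 1 ^ 3 * (moment_root \<rho> d 1 * unif_range T')"
    using T T' p A unif_minoration[OF adm(1) meas(1) prob(1) smp \<kappa>]
    by (intro minoration_transfer[OF \<rho> \<kappa>]) auto
  then have "\<kappa> / (6144 * exp 1 ^ 3) * A \<le> moment_root \<rho> d 1 * unif_range T'"
    by (simp add: divide_le_eq mult_ac)
  then have "ennreal (\<kappa> / (6144 * exp 1 ^ 3) * A) \<le> (\<integral>\<^sup>+x. range_on T' x \<partial>?\<mu>)"
    unfolding rg[OF T'(2)] by (rule ennreal_leI)
  also have "\<dots> \<le> (\<integral>\<^sup>+x. range_on T x \<partial>?\<mu>)"
    using T'(1) by (intro nn_integral_mono range_on_mono)
  finally show "ennreal (\<kappa> / (6144 * exp 1 ^ 3) * A) \<le>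
      (\<integral>\<^sup>+x. (SUP ts\<in>T \<times> T. ennreal (ipd d (\<lambda>i. fst ts i - snd ts i) x)) \<partial>?\<mu>)"
    by (simp add: range_on_def)
qed

theorem theorem5p2:
  shows "\<exists>C6>0. \<forall>(d::nat) K \<phi>1 \<phi>2 (\<kappa>::real).
     sym_convex_body d K \<and> admissible_phi \<phi>1 \<and> admissible_phi \<phi>2 \<and>
     dens_phi \<phi>1 d K \<in> borel_measurable (lebRd d) \<and>
     dens_phi \<phi>2 d K \<in> borel_measurable (lebRd d) \<and>
     prob_space (density (lebRd d) (dens_phi \<phi>1 d K)) \<and>
     prob_space (density (lebRd d) (dens_phi \<phi>2 d K)) \<and>
     \<kappa> > 0 \<and> SMP d (density (lebRd d) (dens_phi \<phi>1 d K)) \<kappa>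
     \<longrightarrow> SMP d (density (lebRd d) (dens_phi \<phi>2 d K)) (\<kappa> / C6)"
  by (intro exI[of _ "6144 * exp 1 ^ 3"] conjI allI impI SMP_transfer) auto

end
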